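(* Let $\alpha \in (0,1]$. There are constants $L_0'' = L_0''(\alpha) > 0$ and $C = C(\alpha) > 0$ such that for every $L \geq L_0''$, all $\alpha$-Hölder continuous functions $\phi, \psi : \mathbb{T}^2 \to \mathbb{R}$, and all $n \geq 2$, $$\left| \int \phi \circ F_L^n \cdot \psi - \int \phi \int \psi \right| \leq C \|\phi\|_\alpha \|\psi\|_\alpha \cdot n L^{-\frac{\alpha}{3\alpha+4}} .$$ In particular $C$ is independent of $L, \psi, \phi$.
   Context: $\mathbb{T}^2 = \mathbb{R}^2/\mathbb{Z}^2$ with its flat metric and geodesic distance $d_{\mathbb{T}^2}$. $F_L : \mathbb{T}^2 \to \mathbb{T}^2$ is the standard map with coefficient $L$, in the coordinates $F_L(x,y) = (L \sin(2\pi x) + 2x - y \ (\mathrm{mod}\ 1),\ x)$ (this is the Chirikov standard map up to conjugation by a linear toral automorphism). $F_L^n$ denotes the $n$-fold iterate of $F_L$. All integrals are with respect to Lebesgue measure on $\mathbb{T}^2$. For $\alpha\in(0,1]$, $[\varphi]_\alpha = \sup_{p \neq q} \frac{|\varphi(p)-\varphi(q)|}{d_{\mathbb{T}^2}(p,q)^\alpha}$ and $\|\varphi\|_\alpha = \|\varphi\|_{C^0} + [\varphi]_\alpha$. *)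

theory Defs
  imports "HOL-Analysis.Analysis"
begin

definition lattice_rel :: "real \<times> real \<Rightarrow> real \<times> real \<Rightarrow> bool" where
  "lattice_rel u v \<longleftrightarrow> fst u - fst v \<in> \<int> \<and> snd u - snd v \<in> \<int>"

lemma equivp_lattice_rel: "equivp lattice_rel"
proof (rule equivpI)
  show "reflp lattice_rel"
    by (rule reflpI) (simp add: lattice_rel_def)
  show "symp lattice_rel"
  proof (rule sympI)
    fix u v assume "lattice_rel u v"
    then have "- (fst u - fst v) \<in> \<int>" "- (snd u - snd v) \<in> \<int>"
      unfolding lattice_rel_def using Ints_minus by blast+
    then show "lattice_rel v u" by (simp add: lattice_rel_def)
  qed
  show "transp lattice_rel"
  proof (rule transpI)
    fix u v w assume "lattice_rel u v" "lattice_rel v w"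
    then have "(fst u - fst v) + (fst v - fst w) \<in> \<int>" "(snd u - snd v) + (snd v - snd w) \<in> \<int>"
      unfolding lattice_rel_def using Ints_add by blast+
    then show "lattice_rel u w" by (simp add: lattice_rel_def)
  qed
qed

quotient_type torus2 = "real \<times> real" / lattice_rel
  morphisms torus_rep torus_proj
  by (rule equivp_lattice_rel)

lemma torus_proj_eq_iff: "torus_proj u = torus_proj v \<longleftrightarrow> lattice_rel u v"
  by (rule torus2.abs_eq_iff)

lemma torus_proj_rep [simp]: "torus_proj (torus_rep p) = p"
  by (metis Quotient_torus2 Quotient_abs_rep)

text \<open>
  The geodesic distance of the flat torus: the least Euclidean distance between lifts.
\<close>

instantiation torus2 :: metric_space
begin

definition dist_torus2 :: "torus2 \<Rightarrow> torus2 \<Rightarrow> real" where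
  "dist_torus2 p q = Inf {dist u v |u v. torus_proj u = p \<and> torus_proj v = q}"

definition uniformity_torus2 :: "(torus2 \<times> torus2) filter" where
  "uniformity_torus2 = (INF e\<in>{0 <..}. principal {(x, y). dist x y < e})"

definition open_torus2 :: "torus2 set \<Rightarrow> bool" where
  "open_torus2 U \<longleftrightarrow> (\<forall>x\<in>U. \<forall>\<^sub>F (x', y) in uniformity. x' = x \<longrightarrow> y \<in> U)"

lemma dist_torus2_le: "dist (torus_proj u) (torus_proj v) \<le> dist u v"
  unfolding dist_torus2_def by (rule cInf_lower) (blast, auto intro!: bdd_belowI[of _ 0])

lemma dist_torus2_less:
  assumes "dist p q < e"
  obtains u v where "torus_proj u = p" "torus_proj v = q" "dist u v < e"
proof -
  have "{dist u v |u v. torus_proj u = p \<and> torus_proj v = q} \<noteq> {}"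
    using torus_proj_rep by blast
  from cInf_lessD[OF this assms[unfolded dist_torus2_def]] show ?thesis
    using that by blast
qed

lemma dist_torus2_nonneg: "0 \<le> dist p (q :: torus2)"
  using dist_torus2_less[of p q 0] by (metis not_less zero_le_dist)

instance
proof
  show "uniformity = (INF e\<in>{0 <..}. principal {(x, y :: torus2). dist x y < e})"
    by (rule uniformity_torus2_def)
  show "open U \<longleftrightarrow> (\<forall>x\<in>U. \<forall>\<^sub>F (x', y) in uniformity. x' = x \<longrightarrow> y \<in> U)" for U :: "torus2 set"
    by (rule open_torus2_def)
  show "dist p q = 0 \<longleftrightarrow> p = q" for p q :: torus2
  proof
    assume "p = q"
    then have "dist p q \<le> 0"
      using dist_torus2_le[of "torus_rep p" "torus_rep p"] by simp
    then show "dist p q = 0" using dist_torus2_nonneg[of p q] by simp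
  next
    assume d: "dist p q = 0"
    show "p = q"
    proof (rule ccontr)
      assume "p \<noteq> q"
      define a where "a = fst (torus_rep p) - fst (torus_rep q)"
      define b where "b = snd (torus_rep p) - snd (torus_rep q)"
      define e where "e = max \<bar>a - of_int (round a)\<bar> \<bar>b - of_int (round b)\<bar>"
      have "\<not> lattice_rel (torus_rep p) (torus_rep q)"
        using \<open>p \<noteq> q\<close> by (metis torus_proj_eq_iff torus_proj_rep)
      then have "a \<notin> \<int> \<or> b \<notin> \<int>" by (simp add: lattice_rel_def a_def b_def)
      then have "e > 0"
        unfolding e_def
        by (metis Ints_of_int abs_le_zero_iff eq_iff_diff_eq_0 linorder_not_le max.bounded_iff)
      with d have "dist p q < e" by simp
      then obtain u v where uv: "torus_proj u = p" "torus_proj v = q" "dist u v < e"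
        by (rule dist_torus2_less)
      have "lattice_rel (torus_rep p) u" "lattice_rel (torus_rep q) v"
        using uv by (simp_all flip: torus_proj_eq_iff)
      then obtain i j k l where
        ij: "fst (torus_rep p) - fst u = of_int i" "snd (torus_rep p) - snd u = of_int j" and
        kl: "fst (torus_rep q) - fst v = of_int k" "snd (torus_rep q) - snd v = of_int l"
        unfolding lattice_rel_def by (meson Ints_cases)
      have "\<bar>a - of_int (round a)\<bar> \<le> \<bar>a - of_int (i - k)\<bar>"
           "\<bar>b - of_int (round b)\<bar> \<le> \<bar>b - of_int (j - l)\<bar>"
        by (rule round_diff_minimal)+
      moreover have "a - of_int (i - k) = fst u - fst v" "b - of_int (j - l) = snd u - snd v"
        using ij kl by (simp_all add: a_def b_def)
      moreover have "\<bar>fst u - fst v\<bar> \<le> dist u v" "\<bar>snd u - snd v\<bar> \<le> dist u v"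
        using dist_fst_le[of u v] dist_snd_le[of u v] by (simp_all add: dist_real_def)
      ultimately have "e \<le> dist u v" by (simp add: e_def)
      with uv(3) show False by simp
    qed
  qed
  show "dist p q \<le> dist p r + dist q r" for p q r :: torus2
  proof (rule field_le_epsilon)
    fix e :: real assume "0 < e"
    then have "dist p r < dist p r + e / 2" "dist q r < dist q r + e / 2" by simp_all
    then obtain u w v w' where
      uw: "torus_proj u = p" "torus_proj w = r" "dist u w < dist p r + e / 2" and
      vw: "torus_proj v = q" "torus_proj w' = r" "dist v w' < dist q r + e / 2"
      by (metis dist_torus2_less)
    have "lattice_rel w w'" using uw(2) vw(2) by (simp flip: torus_proj_eq_iff)
    then have "lattice_rel (v + (w - w')) v" by (simp add: lattice_rel_def)
    then have "torus_proj (v + (w - w')) = q" using vw(1) torus_proj_eq_iff by metis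
    then have "dist p q \<le> dist u (v + (w - w'))"
      using dist_torus2_le[of u "v + (w - w')"] uw(1) by simp
    also have "\<dots> \<le> dist u w + dist w (v + (w - w'))" by (rule dist_triangle)
    also have "dist w (v + (w - w')) = dist v w'"
      by (simp add: dist_norm algebra_simps norm_minus_commute)
    finally show "dist p q \<le> dist p r + dist q r + e" using uw(3) vw(3) by simp
  qed
qed

end

lemma continuous_on_torus_proj: "continuous_on S torus_proj"
  unfolding continuous_on_iff
  by (metis dist_torus2_le order_le_less_trans)

lemma measurable_torus_proj [measurable]: "torus_proj \<in> borel_measurable borel"
  by (rule borel_measurable_continuous_onI) (rule continuous_on_torus_proj)

text \<open>
  Lebesgue measure on the torus: the image of planar Lebesgue measure on a fundamental domain.
\<close>

definition torus_measure :: "torus2 measure" where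
  "torus_measure = distr (restrict_space lborel ({0..<1} \<times> {0..<1})) borel torus_proj"

text \<open>
  The reduction modulo 1 is implicit, because the right-hand side is read in the quotient.
\<close>

lift_definition standard_map :: "real \<Rightarrow> torus2 \<Rightarrow> torus2" is
  "\<lambda>L (x, y). (L * sin (2 * pi * x) + 2 * x - y, x)"
proof -
  fix L :: real and u v :: "real \<times> real"
  assume uv: "lattice_rel u v"
  obtain x y x' y' where [simp]: "u = (x, y)" "v = (x', y')" by fastforce
  from uv obtain i j where i: "x = x' + of_int i" and j: "y = y' + of_int j"
    unfolding lattice_rel_def by (auto elim!: Ints_cases simp: algebra_simps)
  have "sin (2 * pi * x) = sin (2 * pi * x' + 2 * pi * of_int i)"
    by (simp add: i algebra_simps)
  also have "\<dots> = sin (2 * pi * x')"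
    by (simp add: sin_add sin_int_2pin cos_int_2pin)
  finally have sin: "sin (2 * pi * x) = sin (2 * pi * x')" .
  have "L * sin (2 * pi * x) + 2 * x - y - (L * sin (2 * pi * x') + 2 * x' - y') =
      of_int (2 * i - j)"
    unfolding sin by (simp add: i j algebra_simps)
  then have "L * sin (2 * pi * x) + 2 * x - y - (L * sin (2 * pi * x') + 2 * x' - y') \<in> \<int>"
    by (metis Ints_of_int)
  then show "lattice_rel (case u of (x, y) \<Rightarrow> (L * sin (2 * pi * x) + 2 * x - y, x))
      (case v of (x, y) \<Rightarrow> (L * sin (2 * pi * x) + 2 * x - y, x))"
    unfolding lattice_rel_def by (simp add: i)
qed

definition holder_quotients :: "real \<Rightarrow> (torus2 \<Rightarrow> real) \<Rightarrow> real set" where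
  "holder_quotients \<alpha> \<phi> = {\<bar>\<phi> p - \<phi> q\<bar> / dist p q powr \<alpha> |p q. p \<noteq> q}"

definition holder_continuous :: "real \<Rightarrow> (torus2 \<Rightarrow> real) \<Rightarrow> bool" where
  "holder_continuous \<alpha> \<phi> \<longleftrightarrow> bdd_above (holder_quotients \<alpha> \<phi>)"

definition holder_seminorm :: "real \<Rightarrow> (torus2 \<Rightarrow> real) \<Rightarrow> real" where
  "holder_seminorm \<alpha> \<phi> = Sup (holder_quotients \<alpha> \<phi>)"

definition sup_norm :: "(torus2 \<Rightarrow> real) \<Rightarrow> real" where
  "sup_norm \<phi> = (SUP p. \<bar>\<phi> p\<bar>)"

text \<open>
  Real suprema are meaningful only for bounded sets, so this is the Hoelder norm only of functions
  satisfying \<^const>\<open>holder_continuous\<close>; such functions are bounded as the torus has finite diameter.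
\<close>

definition holder_norm :: "real \<Rightarrow> (torus2 \<Rightarrow> real) \<Rightarrow> real" where
  "holder_norm \<alpha> \<phi> = sup_norm \<phi> + holder_seminorm \<alpha> \<phi>"

end

theory Submission
  imports Defs
begin

text \<open>
  A point of the torus is a pair of consecutive positions \<open>(x\<^sub>n, x\<^sub>n\<^sub>-\<^sub>1)\<close> of the recurrence
  \<open>x\<^sub>n\<^sub>+\<^sub>1 = L sin (2 \<pi> x\<^sub>n) + 2 x\<^sub>n - x\<^sub>n\<^sub>-\<^sub>1\<close>. The initial \<open>y = x\<^sub>-\<^sub>1\<close> is fixed and \<open>x = x\<^sub>0\<close> varies over the circle.
  Away from the critical points of the kick, \<open>dx\<^sub>n/dx\<close> is multiplied at each step by something of order
  \<open>L\<close>, so \<open>x\<^sub>n\<close> oscillates rapidly and the integral over \<open>x\<close> of an observable of \<open>(x\<^sub>n, x\<^sub>n\<^sub>-\<^sub>1)\<close> is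
  almost its mean in the first variable.

  This is made quantitative by one integration by parts over the whole circle. An observable of zero
  mean in the first variable is the derivative, in that variable, of a bounded periodic function
  \<open>\<Phi>\<close>; along the line it equals \<open>d\<Phi>/dx\<close> divided by \<open>dx\<^sub>n/dx\<close>, up to a small term
  (\<open>oscillatory_integral_bound\<close>). The division requires a smooth weight that vanishes unless every
  kick along the orbit expands by at least \<open>K\<close>. On its support the second derivative of \<open>x\<^sub>n\<close> is at
  most a multiple of \<open>L / K\<^sup>2\<close> times the square of the first (\<open>distortion\<close>), and the derivative of the
  weight relative to \<open>dx\<^sub>n/dx\<close> obeys a bound of the same order, so \<open>K\<close> must exceed \<open>sqrt L\<close>. The
  weight removes mass \<open>O(K / L)\<close> at each of the \<open>n\<close> times because the map preserves Lebesgue measure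
  (\<open>orbit_cutoff_mass\<close>, \<open>integral_cutoff_complement\<close>). Hoelder observables are first averaged over
  length \<open>\<epsilon>\<close> in the direction in which they are to be differentiated (\<open>mollification_1d\<close>,
  \<open>mollified_primitive\<close>). Taking \<open>K = L powr (3/4)\<close> and \<open>\<epsilon> = L powr (- 1/4)\<close>, the total error is at most a
  multiple of \<open>n L powr (- \<alpha>/4)\<close>.

  A general observable reduces to two of zero horizontal mean, one read after \<open>n\<close> steps and one
  after \<open>n - 1\<close> (\<open>correlation_decay\<close>).
\<close>

section \<open>Primitives and mollification\<close>

text \<open>
  The antiderivative vanishing at 0, as an integral over a fixed interval. Unlike an integral from 0
  to \<^term>\<open>s\<close> it covers both signs of \<^term>\<open>s\<close> at once, and its continuous dependence on
  parameters of \<^term>\<open>f\<close> is an instance of continuity of parametric integrals. Orbits are followed in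
  the plane rather than on the torus, so negative arguments do occur.
\<close>

definition primitive :: "(real \<Rightarrow> real) \<Rightarrow> real \<Rightarrow> real" where
  "primitive f s = integral {0..1} (\<lambda>t. s * f (s * t))"

lemma primitive_has_derivative:
  assumes "continuous_on UNIV f"
  shows "(primitive f has_real_derivative f s) (at s)"
proof -
  have "\<exists>F. \<forall>x :: real. -\<infinity> < ereal x \<longrightarrow> x < \<infinity> \<longrightarrow> (F has_vector_derivative f x) (at x)"
    using assms by (intro einterval_antiderivative) (auto simp: continuous_on_eq_continuous_at)
  then obtain F where F: "\<And>x. (F has_real_derivative f x) (at x)"
    by (auto simp: has_real_derivative_iff_has_vector_derivative)
  have "primitive f s = F s - F 0" for s
  proof -
    have "((\<lambda>t. s * f (s * t)) has_integral F (s * 1) - F (s * 0)) {0..1}"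
    proof (rule fundamental_theorem_of_calculus)
      show "((\<lambda>t. F (s * t)) has_vector_derivative s * f (s * t)) (at t within {0..1})" for t
        unfolding has_real_derivative_iff_has_vector_derivative[symmetric]
        by (rule DERIV_subset, rule DERIV_chain2[THEN DERIV_cong, OF F])
          (auto intro!: derivative_eq_intros)
    qed simp
    from integral_unique[OF this] show ?thesis unfolding primitive_def by simp
  qed
  then have "primitive f = (\<lambda>s. F s - F 0)" by auto
  then show ?thesis using F by (auto intro!: derivative_eq_intros)
qed

lemma primitive_eq_integral:
  assumes "continuous_on UNIV f" "a \<le> b"
  shows "integral {a..b} f = primitive f b - primitive f a"
  by (intro integral_unique fundamental_theorem_of_calculus assms(2))
    (auto simp: has_real_derivative_iff_has_vector_derivative[symmetric]
      intro: DERIV_subset primitive_has_derivative[OF assms(1)])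

lemma primitive_0 [simp]: "primitive f 0 = 0"
  by (simp add: primitive_def)

lemma primitive_shift:
  assumes "continuous_on UNIV f" "\<And>s. f (s + 1) = f s"
  shows "primitive f (s + 1) - primitive f s = integral {0..1} f"
proof -
  have "((\<lambda>s. primitive f (s + 1) - primitive f s) has_real_derivative 0) (at s)" for s
    using DERIV_diff[OF iffD1[OF DERIV_shift primitive_has_derivative[OF assms(1), of "s + 1"]]
        primitive_has_derivative[OF assms(1), of s]]
    by (simp add: assms(2))
  then have "primitive f (s + 1) - primitive f s = primitive f (0 + 1) - primitive f 0"
    using DERIV_isconst_all[of "\<lambda>s. primitive f (s + 1) - primitive f s"] by blast
  also have "\<dots> = integral {0..1} f" using primitive_eq_integral[OF assms(1), of 0 1] by simp
  finally show ?thesis .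
qed

text \<open>
  With zero mean the primitive is itself periodic, so it does not grow: this is where vanishing of
  the mean enters the whole argument.
\<close>

lemma primitive_bound:
  assumes f: "continuous_on UNIV f" "\<And>s. f (s + 1) = f s" "integral {0..1} f = 0"
    and A: "\<And>s. \<bar>f s\<bar> \<le> A"
  shows "\<bar>primitive f s\<bar> \<le> A"
proof -
  interpret periodic_fun_simple' "primitive f"
    by unfold_locales (use primitive_shift[OF f(1,2)] f(3) in simp)
  have "primitive f s = primitive f (frac s + of_int \<lfloor>s\<rfloor>)" by (simp add: frac_def)
  also have "\<dots> = primitive f (frac s)" by (rule plus_of_int)
  finally have eq: "primitive f s = primitive f (frac s)" .
  have "norm (primitive f (frac s) - primitive f 0) \<le> A * norm (frac s - 0)"
    using A by (intro field_differentiable_bound[of UNIV _ f] primitive_has_derivative f) auto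
  also have "\<dots> \<le> A" using frac_lt_1[of s] A[of 0] by (auto intro!: mult_left_le)
  finally show ?thesis using eq by simp
qed

lemma integral_periodic_reflect:
  fixes f :: "real \<Rightarrow> real"
  assumes "continuous_on UNIV f" "\<And>s. f (s + 1) = f s"
  shows "integral {0..1} (\<lambda>y. f (c - y)) = integral {0..1} f"
proof -
  have "((\<lambda>y. f (c - y)) has_integral (- primitive f (c - 1)) - (- primitive f (c - 0))) {0..1}"
  proof (rule fundamental_theorem_of_calculus)
    show "((\<lambda>y. - primitive f (c - y)) has_vector_derivative f (c - t)) (at t within {0..1})" for t
      unfolding has_real_derivative_iff_has_vector_derivative[symmetric]
      by (rule DERIV_subset, rule DERIV_minus[THEN DERIV_cong],
          rule DERIV_chain2[OF primitive_has_derivative[OF assms(1)]])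
        (auto intro!: derivative_eq_intros)
  qed simp
  then show ?thesis using primitive_shift[OF assms, of "c - 1"] by (simp add: integral_unique)
qed

text \<open>
  The average of a function over \<open>[x, x + \<epsilon>]\<close> is a difference quotient of its primitive, and by the mean
  value theorem it is one of the values taken there. Both mollifications below rest on this: an
  average inherits sup bounds, and it moves a Hoelder function by at most the oscillation on scale
  \<^term>\<open>\<epsilon>\<close>.
\<close>

lemma difference_quotient_mean_value:
  fixes h h' :: "real \<Rightarrow> real"
  assumes "\<And>x. (h has_real_derivative h' x) (at x)" "0 < \<epsilon>"
  obtains \<xi> where "\<bar>\<xi> - x\<bar> \<le> \<epsilon>" "(h (x + \<epsilon>) - h x) / \<epsilon> = h' \<xi>"
proof -
  obtain z where "x < z" "z < x + \<epsilon>" "h (x + \<epsilon>) - h x = \<epsilon> * h' z"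
    using MVT2[of x "x + \<epsilon>" h h'] assms by auto
  then show ?thesis using that[of z] assms(2) by auto
qed

text \<open>
  The observable multiplying the oscillating factor has to be differentiated in the integration by
  parts; averaging over length \<^term>\<open>\<delta>\<close> buys a derivative of size \<open>1 / \<delta>\<close>.
\<close>

lemma mollification_1d:
  fixes h :: "real \<Rightarrow> real"
  assumes "continuous_on UNIV h" "0 < \<delta>" "0 < \<alpha>" and B: "\<And>x. \<bar>h x\<bar> \<le> B"
    and hol: "\<And>x x'. \<bar>h x - h x'\<bar> \<le> B * \<bar>x - x'\<bar> powr \<alpha>"
  obtains g g' where "\<And>x. (g has_real_derivative g' x) (at x)" "\<And>x. \<bar>g x\<bar> \<le> B"
    "\<And>x. \<bar>g' x\<bar> \<le> 2 * B / \<delta>" "\<And>x. \<bar>h x - g x\<bar> \<le> B * \<delta> powr \<alpha>"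
proof
  define g where "g x = (primitive h (x + \<delta>) - primitive h x) / \<delta>" for x
  show "(g has_real_derivative (h (x + \<delta>) - h x) / \<delta>) (at x)" for x
    unfolding g_def
    using DERIV_cdivide[OF DERIV_diff[OF
        iffD1[OF DERIV_shift primitive_has_derivative[OF assms(1), of "x + \<delta>"]]
        primitive_has_derivative[OF assms(1), of x]], of \<delta>] .
  have g: "\<exists>\<xi>. \<bar>\<xi> - x\<bar> \<le> \<delta> \<and> g x = h \<xi>" for x
    using difference_quotient_mean_value[of "primitive h" h \<delta> x] assms(1,2)
    by (metis g_def primitive_has_derivative)
  show "\<bar>g x\<bar> \<le> B" for x using g[of x] B by metis
  have "\<bar>h (x + \<delta>) - h x\<bar> \<le> 2 * B" for x using B[of x] B[of "x + \<delta>"] by linarith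
  then show "\<bar>(h (x + \<delta>) - h x) / \<delta>\<bar> \<le> 2 * B / \<delta>" for x
    using \<open>0 < \<delta>\<close> by (simp add: divide_right_mono)
  show "\<bar>h x - g x\<bar> \<le> B * \<delta> powr \<alpha>" for x
  proof -
    obtain \<xi> where \<xi>: "\<bar>\<xi> - x\<bar> \<le> \<delta>" "g x = h \<xi>" using g by blast
    have "\<bar>h x - g x\<bar> \<le> B * \<bar>x - \<xi>\<bar> powr \<alpha>" using hol \<xi>(2) by simp
    also have "\<dots> \<le> B * \<delta> powr \<alpha>"
      using \<xi>(1) B[of 0] \<open>0 < \<alpha>\<close> by (intro mult_left_mono powr_mono2) (auto simp: abs_minus_commute)
    finally show ?thesis .
  qed
qed

lemma primitive_continuous_param:
  fixes \<phi> :: "real \<times> real \<Rightarrow> real"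
  assumes "continuous_on UNIV \<phi>"
  shows "continuous_on UNIV (\<lambda>(s, y). primitive (\<lambda>t. \<phi> (t, y)) s)"
proof -
  have "continuous_on (UNIV \<times> cbox 0 1) (\<lambda>(u, t). fst u * \<phi> (fst u * t, snd u :: real))"
    unfolding case_prod_unfold
    by (intro continuous_intros continuous_on_compose2[OF assms]) auto
  from integral_continuous_on_param[OF this] show ?thesis
    by (simp add: primitive_def case_prod_unfold)
qed

text \<open>
  Integrating in both variables produces a function that is jointly differentiable although
  \<^term>\<open>\<phi>\<close> is only continuous: each partial derivative undoes one of the two integrations, which may
  be carried out in either order.
\<close>

lemma double_primitive:
  fixes \<phi> :: "real \<times> real \<Rightarrow> real"
  assumes "continuous_on UNIV \<phi>"
  obtains \<Psi> :: "real \<Rightarrow> real \<Rightarrow> real" where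
    "\<And>s y. (\<Psi> s has_real_derivative primitive (\<lambda>t. \<phi> (t, y)) s) (at y)"
    "\<And>s y. ((\<lambda>(s, y). \<Psi> s y) has_derivative
        (\<lambda>(ds, dy). primitive (\<lambda>r. \<phi> (s, r)) y * ds + primitive (\<lambda>t. \<phi> (t, y)) s * dy)) (at (s, y))"
proof
  define \<Psi> where "\<Psi> s y = primitive (\<lambda>r. primitive (\<lambda>t. \<phi> (t, r)) s) y" for s y
  have c1: "continuous_on UNIV (\<lambda>r. primitive (\<lambda>t. \<phi> (t, r)) s)" for s
    using continuous_on_compose2[OF primitive_continuous_param[OF assms], of UNIV "\<lambda>r. (s, r)"]
    by (simp add: continuous_intros)
  have c2: "continuous_on UNIV (\<lambda>t. primitive (\<lambda>r. \<phi> (t, r)) y)" for y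
  proof -
    have "continuous_on UNIV (\<lambda>u. \<phi> (snd u, fst u))"
      by (intro continuous_on_compose2[OF assms] continuous_intros) auto
    from continuous_on_compose2[OF primitive_continuous_param[OF this], of UNIV "\<lambda>t. (y, t)"]
    show ?thesis by (simp add: continuous_intros)
  qed
  have swap: "\<Psi> s y = primitive (\<lambda>t. primitive (\<lambda>r. \<phi> (t, r)) y) s" for s y
  proof -
    have "continuous_on (cbox (0,0) (1,1)) (\<lambda>(r, t). y * (s * \<phi> (s * t, y * r)))"
      unfolding case_prod_unfold
      by (intro continuous_intros continuous_on_compose2[OF assms]) auto
    from integral_swap_continuous[OF this] show ?thesis
      by (simp add: \<Psi>_def primitive_def mult.left_commute flip: integral_mult_right)
  qed
  have 1: "((\<lambda>s. \<Psi> s y) has_real_derivative primitive (\<lambda>r. \<phi> (s, r)) y) (at s)" for s y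
    unfolding swap using primitive_has_derivative[OF c2] .
  show 2: "(\<Psi> s has_real_derivative primitive (\<lambda>t. \<phi> (t, y)) s) (at y)" for s y
  proof -
    have "\<Psi> s = primitive (\<lambda>r. primitive (\<lambda>t. \<phi> (t, r)) s)" by (simp add: \<Psi>_def fun_eq_iff)
    then show ?thesis using primitive_has_derivative[OF c1] by simp
  qed
  show "((\<lambda>(s, y). \<Psi> s y) has_derivative
        (\<lambda>(ds, dy). primitive (\<lambda>r. \<phi> (s, r)) y * ds + primitive (\<lambda>t. \<phi> (t, y)) s * dy)) (at (s, y))"
    for s y
  proof -
    have "((\<lambda>(s, y). \<Psi> s y) has_derivative
        (\<lambda>(ds, dy). primitive (\<lambda>r. \<phi> (s, r)) y * ds +
          blinfun_apply (blinfun_mult_right (primitive (\<lambda>t. \<phi> (t, y)) s)) dy)) (at (s, y) within UNIV \<times> UNIV)"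
    proof (rule has_derivative_partialsI)
      show "((\<lambda>x. \<Psi> x y) has_derivative (*) (primitive (\<lambda>r. \<phi> (s, r)) y)) (at s within UNIV)"
        using 1 by (simp add: has_field_derivative_def)
      show "(\<Psi> x has_derivative
        blinfun_apply (blinfun_mult_right (primitive (\<lambda>t. \<phi> (t, y)) x))) (at y within UNIV)" for x y
        using 2 by (simp add: has_field_derivative_def)
      have "isCont (\<lambda>(x, y). primitive (\<lambda>t. \<phi> (t, y)) x) (s, y)"
        using primitive_continuous_param[OF assms] by (simp add: continuous_on_eq_continuous_at)
      then show "continuous (at (s, y) within UNIV \<times> UNIV)
          (\<lambda>(x, y). blinfun_mult_right (primitive (\<lambda>t. \<phi> (t, y)) x))"
        unfolding case_prod_unfold
        by (intro bounded_linear.continuous[OF bounded_linear_blinfun_mult_right]) simp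
    qed auto
    then show ?thesis by simp
  qed
qed

text \<open>
  The antiderivative in the first variable of an observable of zero mean in that variable,
  averaged over \<open>[y, y + \<epsilon>]\<close> in the second variable so that it can be differentiated along arbitrary
  curves in the plane. It is the difference quotient, in the second variable, of the double primitive.
\<close>

lemma mollified_primitive:
  fixes \<phi> :: "real \<times> real \<Rightarrow> real"
  assumes cont: "continuous_on UNIV \<phi>" and "0 < \<epsilon>" "0 < \<alpha>"
    and per: "\<And>s y. \<phi> (s + 1, y) = \<phi> (s, y)"
    and mean: "\<And>y. integral {0..1} (\<lambda>s. \<phi> (s, y)) = 0"
    and A: "\<And>u. \<bar>\<phi> u\<bar> \<le> A"
    and hol: "\<And>s y y'. \<bar>\<phi> (s, y) - \<phi> (s, y')\<bar> \<le> A * \<bar>y - y'\<bar> powr \<alpha>"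
  obtains \<Phi> \<Phi>\<^sub>1 \<Phi>\<^sub>2 :: "real \<times> real \<Rightarrow> real" where
    "\<And>u. (\<Phi> has_derivative (\<lambda>v. \<Phi>\<^sub>1 u * fst v + \<Phi>\<^sub>2 u * snd v)) (at u)"
    "continuous_on UNIV \<Phi>\<^sub>1"
    "\<And>u. \<bar>\<Phi> u\<bar> \<le> A" "\<And>u. \<bar>\<Phi>\<^sub>2 u\<bar> \<le> 2 * A / \<epsilon>" "\<And>u. \<bar>\<phi> u - \<Phi>\<^sub>1 u\<bar> \<le> A * \<epsilon> powr \<alpha>"
proof -
  obtain \<Psi> :: "real \<Rightarrow> real \<Rightarrow> real" where
    d2: "\<And>s y. (\<Psi> s has_real_derivative primitive (\<lambda>t. \<phi> (t, y)) s) (at y)" and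
    d: "\<And>s y. ((\<lambda>(s, y). \<Psi> s y) has_derivative
        (\<lambda>(ds, dy). primitive (\<lambda>r. \<phi> (s, r)) y * ds + primitive (\<lambda>t. \<phi> (t, y)) s * dy)) (at (s, y))"
    using double_primitive[OF cont] by blast
  define \<Phi> where "\<Phi> u = (\<Psi> (fst u) (snd u + \<epsilon>) - \<Psi> (fst u) (snd u)) / \<epsilon>" for u
  define \<Phi>1 where "\<Phi>1 u = (primitive (\<lambda>r. \<phi> (fst u, r)) (snd u + \<epsilon>) - primitive (\<lambda>r. \<phi> (fst u, r)) (snd u)) / \<epsilon>" for u
  define \<Phi>2 where "\<Phi>2 u = (primitive (\<lambda>t. \<phi> (t, snd u + \<epsilon>)) (fst u) - primitive (\<lambda>t. \<phi> (t, snd u)) (fst u)) / \<epsilon>" for u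
  have c1: "continuous_on UNIV (\<lambda>t. \<phi> (t, y))" for y
    by (intro continuous_on_compose2[OF cont] continuous_intros) auto
  have c2: "continuous_on UNIV (\<lambda>r. \<phi> (s, r))" for s
    by (intro continuous_on_compose2[OF cont] continuous_intros) auto
  have pb: "\<bar>primitive (\<lambda>t. \<phi> (t, y)) s\<bar> \<le> A" for s y
    by (rule primitive_bound[OF c1 per mean A])
  show ?thesis
  proof
    show "(\<Phi> has_derivative (\<lambda>v. \<Phi>1 u * fst v + \<Phi>2 u * snd v)) (at u)" for u
    proof -
      have D: "((\<lambda>u. \<Psi> (fst u) (snd u + a)) has_derivative
        (\<lambda>v. primitive (\<lambda>r. \<phi> (fst u, r)) (snd u + a) * fst v
            + primitive (\<lambda>t. \<phi> (t, snd u + a)) (fst u) * snd v)) (at u)" for a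
      proof -
        have "((\<lambda>u. (fst u, snd u + a)) has_derivative (\<lambda>v. (fst v, snd v))) (at u)"
          by (auto intro!: derivative_eq_intros)
        from has_derivative_compose[OF this d] show ?thesis by (simp add: case_prod_unfold)
      qed
      have "((\<lambda>u. (\<Psi> (fst u) (snd u + \<epsilon>) - \<Psi> (fst u) (snd u)) * inverse \<epsilon>) has_derivative
         (\<lambda>v. ((primitive (\<lambda>r. \<phi> (fst u, r)) (snd u + \<epsilon>) * fst v
            + primitive (\<lambda>t. \<phi> (t, snd u + \<epsilon>)) (fst u) * snd v) - 
            (primitive (\<lambda>r. \<phi> (fst u, r)) (snd u) * fst v
            + primitive (\<lambda>t. \<phi> (t, snd u)) (fst u) * snd v)) * inverse \<epsilon>)) (at u)"
        using D[of \<epsilon>] D[of 0] by (intro has_derivative_mult_left has_derivative_diff) simp_all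
      then show ?thesis
        by (rule has_derivative_eq_rhs[OF has_derivative_transform[rotated 2]])
          (auto simp: \<Phi>_def \<Phi>1_def \<Phi>2_def divide_inverse algebra_simps)
    qed
    have "continuous_on UNIV (\<lambda>u. \<phi> (snd u, fst u))"
      by (intro continuous_on_compose2[OF cont] continuous_intros) auto
    note C = primitive_continuous_param[OF this, simplified case_prod_unfold]
    have "continuous_on UNIV (\<lambda>u. primitive (\<lambda>r. \<phi> (fst u, r)) (snd u + a))" for a
      using continuous_on_compose2[OF C, of UNIV "\<lambda>u. (snd u + a, fst u)"]
      by (simp add: continuous_intros)
    from this[of \<epsilon>] this[of 0] show "continuous_on UNIV \<Phi>1"
      unfolding \<Phi>1_def using \<open>0 < \<epsilon>\<close> by (auto intro!: continuous_intros)
    show "\<bar>\<Phi> u\<bar> \<le> A" for u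
      using difference_quotient_mean_value[OF d2 \<open>0 < \<epsilon>\<close>, of "snd u" "fst u"] pb
      unfolding \<Phi>_def by metis
    show "\<bar>\<Phi>2 u\<bar> \<le> 2 * A / \<epsilon>" for u
    proof -
      have "\<bar>primitive (\<lambda>t. \<phi> (t, snd u + \<epsilon>)) (fst u) - primitive (\<lambda>t. \<phi> (t, snd u)) (fst u)\<bar> \<le> 2 * A"
        using pb[of "snd u + \<epsilon>" "fst u"] pb[of "snd u" "fst u"] by linarith
      then show ?thesis using \<open>0 < \<epsilon>\<close> by (simp add: \<Phi>2_def divide_right_mono)
    qed
    show "\<bar>\<phi> u - \<Phi>1 u\<bar> \<le> A * \<epsilon> powr \<alpha>" for u
    proof -
      obtain \<xi> where \<xi>: "\<bar>\<xi> - snd u\<bar> \<le> \<epsilon>" "\<Phi>1 u = \<phi> (fst u, \<xi>)"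
        using difference_quotient_mean_value[OF primitive_has_derivative[OF c2] \<open>0 < \<epsilon>\<close>]
        unfolding \<Phi>1_def by metis
      have "\<bar>\<phi> u - \<Phi>1 u\<bar> \<le> A * \<bar>snd u - \<xi>\<bar> powr \<alpha>" using hol[of "fst u" "snd u"] \<xi>(2) by simp
      also have "\<dots> \<le> A * \<epsilon> powr \<alpha>"
        using \<xi>(1) A[of 0] \<open>0 < \<alpha>\<close>
        by (intro mult_left_mono powr_mono2) (auto simp: abs_minus_commute)
      finally show ?thesis .
    qed
  qed
qed

section \<open>Expansion and non-stationary phase on horizontal lines\<close>

definition kick :: "real \<Rightarrow> real \<Rightarrow> real" where
  "kick L x = L * sin (2 * pi * x) + 2 * x"

definition kick' :: "real \<Rightarrow> real \<Rightarrow> real" where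
  "kick' L x = 2 * pi * L * cos (2 * pi * x) + 2"

definition kick'' :: "real \<Rightarrow> real \<Rightarrow> real" where
  "kick'' L x = - (4 * pi\<^sup>2 * L * sin (2 * pi * x))"

lemma kick_has_derivative: "(kick L has_real_derivative kick' L x) (at x)"
  unfolding kick_def kick'_def by (auto intro!: derivative_eq_intros)

lemma kick'_has_derivative: "(kick' L has_real_derivative kick'' L x) (at x)"
  unfolding kick'_def kick''_def by (auto intro!: derivative_eq_intros simp: power2_eq_square)

lemma kick''_bound:
  assumes "0 \<le> L"
  shows "\<bar>kick'' L x\<bar> \<le> 64 * L"
proof -
  have "pi\<^sup>2 \<le> 4\<^sup>2" using pi_less_4 by (intro power_mono) auto
  then have "4 * pi\<^sup>2 * L * \<bar>sin (2 * pi * x)\<bar> \<le> 4 * 16 * L * 1"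
    using assms by (intro mult_mono) auto
  then show ?thesis using assms by (simp add: kick''_def abs_mult)
qed

lemma max_0_squared_has_derivative:
  "((\<lambda>t::real. (max 0 t)\<^sup>2) has_real_derivative 2 * max 0 t) (at t)"
proof -
  consider "t < 0" | "t = 0" | "t > 0" by linarith
  then show ?thesis
  proof cases
    case 1
    have "((\<lambda>t::real. 0) has_real_derivative 2 * max 0 t) (at t)" using 1 by simp
    then show ?thesis
      by (rule has_field_derivative_transform_within_open[where S = "{..<0}"]) (use 1 in auto)
  next
    case 2
    have "((\<lambda>h::real. max 0 h) \<longlongrightarrow> max 0 0) (at 0)" by (intro tendsto_intros)
    moreover have "(max 0 h)\<^sup>2 / h = max 0 h" for h :: real
      by (simp add: max_def power2_eq_square)
    ultimately show ?thesis using 2 by (simp add: DERIV_def)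
  next
    case 3
    have "((\<lambda>t::real. t\<^sup>2) has_real_derivative 2 * max 0 t) (at t)"
      using 3 by (auto intro!: derivative_eq_intros)
    then show ?thesis
      by (rule has_field_derivative_transform_within_open[where S = "{0<..}"]) (use 3 in auto)
  qed
qed

text \<open>
  The standard map turns the pair of consecutive positions \<open>(x\<^sub>n, x\<^sub>n\<^sub>-\<^sub>1)\<close> into \<open>(x\<^sub>n\<^sub>+\<^sub>1, x\<^sub>n)\<close>, so an
  orbit is a second-order recurrence. Its index is shifted by one: the initial point is
  \<open>(x, y)\<close> with \<^term>\<open>y\<close> at index 0 and \<^term>\<open>x\<close> at index 1. The argument \<^term>\<open>x\<close> comes last because the
  orbit is studied as a function of \<^term>\<open>x\<close> on a horizontal line; the primed versions are the
  derivatives in \<^term>\<open>x\<close>.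
\<close>

fun orbit :: "real \<Rightarrow> real \<Rightarrow> nat \<Rightarrow> real \<Rightarrow> real" where
  "orbit L y 0 x = y"
| "orbit L y (Suc 0) x = x"
| "orbit L y (Suc (Suc n)) x = kick L (orbit L y (Suc n) x) - orbit L y n x"

fun orbit' :: "real \<Rightarrow> real \<Rightarrow> nat \<Rightarrow> real \<Rightarrow> real" where
  "orbit' L y 0 x = 0"
| "orbit' L y (Suc 0) x = 1"
| "orbit' L y (Suc (Suc n)) x = kick' L (orbit L y (Suc n) x) * orbit' L y (Suc n) x - orbit' L y n x"

fun orbit'' :: "real \<Rightarrow> real \<Rightarrow> nat \<Rightarrow> real \<Rightarrow> real" where
  "orbit'' L y 0 x = 0"
| "orbit'' L y (Suc 0) x = 0"
| "orbit'' L y (Suc (Suc n)) x =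
     kick'' L (orbit L y (Suc n) x) * (orbit' L y (Suc n) x)\<^sup>2
     + kick' L (orbit L y (Suc n) x) * orbit'' L y (Suc n) x - orbit'' L y n x"

lemma orbit_has_derivative: "(orbit L y n has_real_derivative orbit' L y n x) (at x)"
proof (induction n rule: induct_nat_012)
  case (ge2 n)
  have "orbit L y (Suc (Suc n)) = (\<lambda>x. kick L (orbit L y (Suc n) x) - orbit L y n x)"
    by (simp add: fun_eq_iff)
  then show ?case
    using DERIV_diff[OF DERIV_chain2[OF kick_has_derivative ge2(2)] ge2(1)] by simp
next
  case 0
  have "orbit L y 0 = (\<lambda>x. y)" by (simp add: fun_eq_iff)
  then show ?case by simp
next
  case 1
  have "orbit L y (Suc 0) = (\<lambda>x. x)" by (simp add: fun_eq_iff)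
  then show ?case by simp
qed

lemma orbit'_has_derivative: "(orbit' L y n has_real_derivative orbit'' L y n x) (at x)"
proof (induction n rule: induct_nat_012)
  case (ge2 n)
  have "orbit' L y (Suc (Suc n)) =
      (\<lambda>x. kick' L (orbit L y (Suc n) x) * orbit' L y (Suc n) x - orbit' L y n x)"
    by (simp add: fun_eq_iff)
  then show ?case
    using DERIV_diff[OF DERIV_mult[OF
          DERIV_chain2[OF kick'_has_derivative orbit_has_derivative[of L y "Suc n"]] ge2(2)] ge2(1)]
    by (simp add: power2_eq_square algebra_simps)
next
  case 0
  have "orbit' L y 0 = (\<lambda>x. 0)" by (simp add: fun_eq_iff)
  then show ?case by simp
next
  case 1
  have "orbit' L y (Suc 0) = (\<lambda>x. 1)" by (simp add: fun_eq_iff)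
  then show ?case by simp
qed

text \<open>
  \<^term>\<open>K\<close> is the expansion demanded at each step. It is kept separate from \<^term>\<open>L\<close>, since the estimates
  need it to lie between \<open>sqrt L\<close> (bounded distortion) and \<^term>\<open>L\<close> (few points excluded).
\<close>

locale strong_kick =
  fixes L K :: real
  assumes K: "6 \<le> K" and L: "0 \<le> L"
begin

text \<open>
  A \<open>C\<^sup>1\<close> weight that vanishes where the kick expands by less than \<^term>\<open>K\<close> and is close to 1 where it
  expands much more. It has the form \<open>v / (v + K\<^sup>4)\<close>, whose denominator never vanishes, with \<open>v\<close> the
  square of a positive part and hence differentiable across the edge of its support.
\<close>

definition cutoff :: "real \<Rightarrow> real" where
  "cutoff x = (max 0 ((kick' L x)\<^sup>2 - K\<^sup>2))\<^sup>2 / ((max 0 ((kick' L x)\<^sup>2 - K\<^sup>2))\<^sup>2 + K ^ 4)"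

lemma denominator_pos: "0 < (m :: real)\<^sup>2 + K ^ 4"
  using K by (intro add_nonneg_pos) auto

lemma cutoff_range: "0 \<le> cutoff x" "cutoff x \<le> 1"
  using denominator_pos[of "max 0 ((kick' L x)\<^sup>2 - K\<^sup>2)"] by (auto simp: cutoff_def)

lemma cutoff_eq_0:
  assumes "\<bar>kick' L x\<bar> < K"
  shows "cutoff x = 0"
proof -
  have "(kick' L x)\<^sup>2 \<le> K\<^sup>2" using assms by (subst power2_abs[symmetric], intro power_mono) auto
  then show ?thesis by (simp add: cutoff_def)
qed

text \<open>
  The weight rises from 0 over the region where \<open>\<bar>kick'\<bar>\<close> is of order \<open>K\<close>, and \<open>kick'\<close> changes at rate
  at most \<open>64 L\<close>; hence a slope of order \<open>L / K\<close>.
\<close>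

lemma cutoff_has_derivative:
  obtains c where "(cutoff has_real_derivative c) (at x)" "\<bar>c\<bar> \<le> 160 * L / K"
proof -
  define g where "g = kick' L x"
  define m where "m = max 0 (g\<^sup>2 - K\<^sup>2)"
  define S where "S = m\<^sup>2 + K ^ 4"
  have "0 \<le> m" by (simp add: m_def)
  have "0 < S" using denominator_pos by (simp add: S_def)
  have dv: "((\<lambda>x. (max 0 ((kick' L x)\<^sup>2 - K\<^sup>2))\<^sup>2) has_real_derivative
      2 * m * (2 * g * kick'' L x)) (at x)"
    unfolding m_def g_def
    by (rule DERIV_chain2[OF max_0_squared_has_derivative])
      (auto intro!: derivative_eq_intros kick'_has_derivative)
  have "((\<lambda>v. v / (v + K ^ 4)) has_real_derivative K ^ 4 / S\<^sup>2) (at (m\<^sup>2))"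
    using \<open>0 < S\<close> unfolding S_def
    by (auto intro!: derivative_eq_intros simp: power2_eq_square)
  from DERIV_chain2[OF this[unfolded m_def g_def] dv]
  have "(cutoff has_real_derivative K ^ 4 / S\<^sup>2 * (2 * m * (2 * g * kick'' L x))) (at x)"
    unfolding cutoff_def .
  moreover have "\<bar>K ^ 4 / S\<^sup>2 * (2 * m * (2 * g * kick'' L x))\<bar> \<le> 160 * L / K"
  proof (cases "m = 0")
    case True
    then show ?thesis using K L by simp
  next
    case False
    then have g: "g\<^sup>2 = m + K\<^sup>2" using \<open>0 \<le> m\<close> by (auto simp: m_def max_def split: if_splits)
    \<comment> \<open>In terms of \<open>S = m\<^sup>2 + K\<^sup>4\<close> both \<open>m K\<^sup>2\<close> and \<open>\<bar>g\<bar> K\<^sup>3\<close> are \<open>O(S)\<close>,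
      so that the two powers of \<open>S\<close> in the denominator are used up.\<close>
    have 1: "m * K\<^sup>2 \<le> S / 2"
      using sum_squares_bound[of m "K\<^sup>2"] by (simp add: S_def power2_eq_square power4_eq_xxxx)
    have "\<bar>g\<bar> * K ^ 3 = (\<bar>g\<bar> * K) * K\<^sup>2" by (simp add: power2_eq_square power3_eq_cube)
    also have "\<dots> \<le> ((m + 2 * K\<^sup>2) / 2) * K\<^sup>2"
      using sum_squares_bound[of "\<bar>g\<bar>" K] g by (intro mult_right_mono) auto
    also have "\<dots> = (m * K\<^sup>2) / 2 + K ^ 4" by (simp add: power2_eq_square power4_eq_xxxx field_simps)
    also have "\<dots> \<le> 5 / 4 * S"
    proof -
      have "K ^ 4 \<le> S" by (simp add: S_def)
      with 1 show ?thesis by simp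
    qed
    finally have 2: "\<bar>g\<bar> * K ^ 3 \<le> 5 / 4 * S" .
    have "\<bar>K ^ 4 / S\<^sup>2 * (2 * m * (2 * g * kick'' L x))\<bar>
        = 4 * \<bar>kick'' L x\<bar> / K * ((m * K\<^sup>2) * (\<bar>g\<bar> * K ^ 3)) / S\<^sup>2"
      using K \<open>0 \<le> m\<close> by (simp add: abs_mult power_def field_simps eval_nat_numeral)
    also have "\<dots> \<le> 4 * (64 * L) / K * ((S / 2) * (5 / 4 * S)) / S\<^sup>2"
    proof (intro divide_right_mono mult_mono[of "4 * \<bar>kick'' L x\<bar> / K"])
      show "(m * K\<^sup>2) * (\<bar>g\<bar> * K ^ 3) \<le> (S / 2) * (5 / 4 * S)"
        using 1 2 K \<open>0 \<le> m\<close> \<open>0 < S\<close> by (intro mult_mono[OF 1 2]) auto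
    qed (use K L \<open>0 \<le> m\<close> kick''_bound[OF L, of x] in auto)
    also have "\<dots> = 160 * L / K" using \<open>0 < S\<close> by (simp add: power2_eq_square)
    finally show ?thesis .
  qed
  ultimately show ?thesis using that by blast
qed

text \<open>
  The points where the first \<^term>\<open>n\<close> kicks along the orbit all expand by at least \<^term>\<open>K\<close>; the product of
  cutoffs below lives on them.
\<close>

definition expanding :: "real \<Rightarrow> nat \<Rightarrow> real \<Rightarrow> bool" where
  "expanding y n x \<longleftrightarrow> (\<forall>k<n. K \<le> \<bar>kick' L (orbit L y (Suc k) x)\<bar>)"

text \<open>
  The recurrence for the derivatives subtracts the previous derivative; as this is the smaller one,
  a kick of strength \<open>\<bar>g\<bar>\<close> still expands by \<open>\<bar>g\<bar> - 1\<close>.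
\<close>

lemma expansion_step:
  assumes "(K - 1) * \<bar>d\<bar> \<le> \<bar>d'\<bar>"
  shows "(\<bar>g\<bar> - 1) * \<bar>d'\<bar> \<le> \<bar>g * d' - d\<bar>"
proof -
  have "1 * \<bar>d\<bar> \<le> (K - 1) * \<bar>d\<bar>" using K by (intro mult_right_mono) auto
  then have "\<bar>d\<bar> \<le> \<bar>d'\<bar>" using assms by linarith
  moreover have "\<bar>g\<bar> * \<bar>d'\<bar> - \<bar>d\<bar> \<le> \<bar>g * d' - d\<bar>"
    using abs_triangle_ineq2[of "g * d'" d] by (simp add: abs_mult)
  ultimately show ?thesis by (simp add: algebra_simps)
qed

lemma expansion:
  assumes "expanding y n x" "k \<le> n"
  shows "(K - 1) * \<bar>orbit' L y k x\<bar> \<le> \<bar>orbit' L y (Suc k) x\<bar>"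
  using assms(2)
proof (induction k)
  case (Suc k)
  have "K \<le> \<bar>kick' L (orbit L y (Suc k) x)\<bar>" using assms(1) Suc.prems by (simp add: expanding_def)
  then have "(K - 1) * \<bar>orbit' L y (Suc k) x\<bar>
      \<le> (\<bar>kick' L (orbit L y (Suc k) x)\<bar> - 1) * \<bar>orbit' L y (Suc k) x\<bar>"
    by (intro mult_right_mono) auto
  also have "\<dots> \<le> \<bar>orbit' L y (Suc (Suc k)) x\<bar>"
    using expansion_step[of "orbit' L y k x" "orbit' L y (Suc k) x"] Suc by simp
  finally show ?case .
qed simp

lemma orbit'_ge_1:
  assumes "expanding y n x" "k \<le> n"
  shows "1 \<le> \<bar>orbit' L y (Suc k) x\<bar>"
  using assms(2)
proof (induction k)
  case (Suc k)
  have "1 * 1 \<le> (K - 1) * \<bar>orbit' L y (Suc k) x\<bar>"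
    using Suc K by (intro mult_mono) auto
  then show ?case using expansion[OF assms(1) Suc.prems] by simp
qed simp

text \<open>
  The ratio of the second derivative to the squared first derivative is the quantity that the
  integration by parts produces. A new kick contributes \<open>kick'' / kick'\<^sup>2\<close>, which is \<open>O(L / K\<^sup>2)\<close>, and
  divides the old ratio by about \<^term>\<open>K\<close>, so the bound reproduces itself.
\<close>

lemma distortion:
  assumes "expanding y n x" "k \<le> Suc n"
  shows "\<bar>orbit'' L y k x\<bar> \<le> 128 * L / K\<^sup>2 * (orbit' L y k x)\<^sup>2"
  using assms(2)
proof (induction k rule: induct_nat_012)
  case (ge2 k)
  define g where "g = kick' L (orbit L y (Suc k) x)"
  define d where "d = orbit' L y (Suc k) x"
  define R where "R = 128 * L / K\<^sup>2"
  have "0 \<le> R" using L by (simp add: R_def)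
  have g: "K \<le> \<bar>g\<bar>" using assms(1) ge2.prems by (simp add: expanding_def g_def)
  have e: "(K - 1) * \<bar>orbit' L y k x\<bar> \<le> \<bar>d\<bar>"
    unfolding d_def using expansion[OF assms(1), of k] ge2.prems by simp
  have "1 * \<bar>orbit' L y k x\<bar> \<le> (K - 1) * \<bar>orbit' L y k x\<bar>" using K by (intro mult_right_mono) auto
  then have "(orbit' L y k x)\<^sup>2 \<le> d\<^sup>2" using e by (simp add: abs_le_square_iff[symmetric])
  then have e0: "\<bar>orbit'' L y k x\<bar> \<le> R * d\<^sup>2"
    using ge2.IH(1) ge2.prems mult_left_mono[OF _ \<open>0 \<le> R\<close>] unfolding R_def[symmetric] by fastforce
  have e1: "\<bar>orbit'' L y (Suc k) x\<bar> \<le> R * d\<^sup>2"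
    using ge2.IH(2) ge2.prems by (simp add: R_def d_def)
  have "(\<bar>g\<bar> - 1) * \<bar>d\<bar> \<le> \<bar>orbit' L y (Suc (Suc k)) x\<bar>"
    using expansion_step[OF e, of g] by (simp add: g_def d_def)
  then have "((\<bar>g\<bar> - 1) * \<bar>d\<bar>)\<^sup>2 \<le> \<bar>orbit' L y (Suc (Suc k)) x\<bar>\<^sup>2"
    using g K by (intro power_mono) auto
  then have sq: "(\<bar>g\<bar> - 1)\<^sup>2 * d\<^sup>2 \<le> (orbit' L y (Suc (Suc k)) x)\<^sup>2" by (simp add: power_mult_distrib)
  have "\<bar>orbit'' L y (Suc (Suc k)) x\<bar>
      \<le> \<bar>kick'' L (orbit L y (Suc k) x)\<bar> * d\<^sup>2 + \<bar>g\<bar> * \<bar>orbit'' L y (Suc k) x\<bar> + \<bar>orbit'' L y k x\<bar>"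
    unfolding orbit''.simps g_def[symmetric] d_def[symmetric]
    by (intro order_trans[OF abs_triangle_ineq4] add_mono order_trans[OF abs_triangle_ineq])
      (auto simp: abs_mult)
  also have "\<dots> \<le> 64 * L * d\<^sup>2 + \<bar>g\<bar> * (R * d\<^sup>2) + R * d\<^sup>2"
    using e0 e1 kick''_bound[OF L] L by (intro add_mono mult_mono) auto
  \<comment> \<open>The constant in \<open>R\<close> turns the new contribution \<open>64 L\<close> into \<open>R K\<^sup>2 / 2\<close>,
    which leaves room for the old ones as soon as \<open>6 \<le> K\<close>.\<close>
  also have "\<dots> = (R * (K\<^sup>2 / 2 + \<bar>g\<bar> + 1)) * d\<^sup>2"
    using K by (simp add: R_def field_simps)
  also have "\<dots> \<le> (R * (\<bar>g\<bar> - 1)\<^sup>2) * d\<^sup>2"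
  proof (intro mult_right_mono mult_left_mono)
    have "K\<^sup>2 \<le> \<bar>g\<bar>\<^sup>2" using g K by (intro power_mono) auto
    moreover have "6 * \<bar>g\<bar> \<le> \<bar>g\<bar> * \<bar>g\<bar>" using g K by (intro mult_right_mono) auto
    ultimately show "K\<^sup>2 / 2 + \<bar>g\<bar> + 1 \<le> (\<bar>g\<bar> - 1)\<^sup>2" by (simp add: power2_eq_square algebra_simps)
  qed (use \<open>0 \<le> R\<close> in auto)
  also have "\<dots> \<le> R * (orbit' L y (Suc (Suc k)) x)\<^sup>2"
    using mult_left_mono[OF sq \<open>0 \<le> R\<close>] by (simp add: mult.assoc)
  finally show ?case by (simp add: R_def)
qed (use L in auto)

definition orbit_cutoff :: "real \<Rightarrow> nat \<Rightarrow> real \<Rightarrow> real" where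
  "orbit_cutoff y n x = (\<Prod>k<n. cutoff (orbit L y (Suc k) x))"

lemma orbit_cutoff_range: "0 \<le> orbit_cutoff y n x" "orbit_cutoff y n x \<le> 1"
  unfolding orbit_cutoff_def by (auto intro!: prod_nonneg prod_le_1 cutoff_range)

text \<open>
  By the chain rule the cutoff at time \<open>k\<close> contributes at most \<open>L / K\<close> times the derivative of the
  orbit at that time. These grow geometrically, so the whole sum is comparable with its last term,
  which is smaller by a factor \<open>K - 1\<close> than the derivative of the orbit one step later. The constant
  is twice \<open>160 L / K\<close> in order to make the induction close.
\<close>

lemma orbit_cutoff_has_derivative:
  obtains c where "(orbit_cutoff y n has_real_derivative c) (at x)"
    "expanding y n x \<Longrightarrow> \<bar>c\<bar> \<le> 320 * L / K / (K - 1) * \<bar>orbit' L y (Suc n) x\<bar>"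
proof -
  have "\<exists>c. (orbit_cutoff y n has_real_derivative c) (at x) \<and>
    (expanding y n x \<longrightarrow> \<bar>c\<bar> \<le> 320 * L / K / (K - 1) * \<bar>orbit' L y (Suc n) x\<bar>)"
  proof (induction n)
    case 0
    have "orbit_cutoff y 0 = (\<lambda>x. 1)" by (simp add: orbit_cutoff_def fun_eq_iff)
    then have "(orbit_cutoff y 0 has_real_derivative 0) (at x)" by simp
    then show ?case using K L by force
  next
    case (Suc n)
    let ?X = "orbit L y (Suc n)" and ?D = "orbit' L y (Suc n) x"
    obtain c where c: "(orbit_cutoff y n has_real_derivative c) (at x)"
      "expanding y n x \<longrightarrow> \<bar>c\<bar> \<le> 320 * L / K / (K - 1) * \<bar>?D\<bar>" using Suc by blast
    obtain b where b: "(cutoff has_real_derivative b) (at (?X x))" "\<bar>b\<bar> \<le> 160 * L / K"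
      by (rule cutoff_has_derivative)
    have "orbit_cutoff y (Suc n) = (\<lambda>x. orbit_cutoff y n x * cutoff (?X x))"
      by (simp add: orbit_cutoff_def fun_eq_iff)
    then have "(orbit_cutoff y (Suc n) has_real_derivative
        c * cutoff (?X x) + b * ?D * orbit_cutoff y n x) (at x)"
      using DERIV_mult[OF c(1) DERIV_chain2[OF b(1) orbit_has_derivative]] by simp
    moreover have "\<bar>c * cutoff (?X x) + b * ?D * orbit_cutoff y n x\<bar>
        \<le> 320 * L / K / (K - 1) * \<bar>orbit' L y (Suc (Suc n)) x\<bar>" if e: "expanding y (Suc n) x"
    proof -
      have e': "expanding y n x" using e by (simp add: expanding_def)
      have "\<bar>c * cutoff (?X x) + b * ?D * orbit_cutoff y n x\<bar>
          \<le> \<bar>c\<bar> * cutoff (?X x) + \<bar>b\<bar> * \<bar>?D\<bar> * orbit_cutoff y n x"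
        using cutoff_range[of "?X x"] orbit_cutoff_range[of y n x]
        by (intro order_trans[OF abs_triangle_ineq]) (simp add: abs_mult)
      also have "\<dots> \<le> (320 * L / K / (K - 1) * \<bar>?D\<bar>) * 1 + (160 * L / K) * \<bar>?D\<bar> * 1"
        using cutoff_range[of "?X x"] orbit_cutoff_range[of y n x] c(2) e' b(2) K L
        by (intro add_mono mult_mono) auto
      also have "\<dots> = (320 * L / K / (K - 1) + 160 * L / K) * \<bar>?D\<bar>" by (simp add: algebra_simps)
      also have "\<dots> \<le> (320 * L / K) * \<bar>?D\<bar>"
      proof (rule mult_right_mono)
        have "320 * L / K / (K - 1) \<le> 320 * L / K / 2"
          using K L by (intro divide_left_mono) auto
        then show "320 * L / K / (K - 1) + 160 * L / K \<le> 320 * L / K" by simp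
      qed simp
      also have "\<dots> = 320 * L / K / (K - 1) * ((K - 1) * \<bar>?D\<bar>)" using K by simp
      also have "\<dots> \<le> 320 * L / K / (K - 1) * \<bar>orbit' L y (Suc (Suc n)) x\<bar>"
        using expansion[OF e, of "Suc n"] K L by (intro mult_left_mono) auto
      finally show ?thesis .
    qed
    ultimately show ?case by blast
  qed
  then show ?thesis using that by blast
qed

text \<open>
  Vanishing on a neighbourhood, and not only at the point, is what makes division by a derivative of
  the orbit harmless: that derivative may have zeros, but only away from the support of the cutoff.
\<close>

lemma orbit_cutoff_locally_0:
  assumes "\<not> expanding y n x"
  shows "orbit_cutoff y n x = 0"
    "\<forall>\<^sub>F z in nhds x. orbit_cutoff y n z = 0"
proof -
  obtain k where k: "k < n" "\<bar>kick' L (orbit L y (Suc k) x)\<bar> < K"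
    using assms by (auto simp: expanding_def not_le)
  have "isCont (\<lambda>z. kick' L (orbit L y (Suc k) z)) x"
    using DERIV_chain2[OF kick'_has_derivative orbit_has_derivative] DERIV_isCont by blast
  then have "((\<lambda>z. \<bar>kick' L (orbit L y (Suc k) z)\<bar>) \<longlongrightarrow> \<bar>kick' L (orbit L y (Suc k) x)\<bar>) (nhds x)"
    using tendsto_at_iff_tendsto_nhds by (intro tendsto_rabs) (auto simp: isCont_def)
  from order_tendstoD(2)[OF this k(2)]
  show ev: "\<forall>\<^sub>F z in nhds x. orbit_cutoff y n z = 0"
  proof eventually_elim
    case (elim z)
    then have "cutoff (orbit L y (Suc k) z) = 0" by (rule cutoff_eq_0)
    then show ?case using k(1) by (auto simp: orbit_cutoff_def intro!: prod_zero)
  qed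
  then show "orbit_cutoff y n x = 0" using eventually_nhds_x_imp_x by blast
qed

text \<open>
  The amplitude of the integration by parts. Its derivative is small because both the cutoff and the
  derivative of the orbit vary slowly on the scale of the expansion.
\<close>

lemma amplitude_has_derivative:
  obtains w where "((\<lambda>x. orbit_cutoff y n x / orbit' L y (Suc n) x) has_real_derivative w) (at x)"
    "\<bar>w\<bar> \<le> 320 * L / K / (K - 1) + 128 * L / K\<^sup>2"
proof (cases "expanding y n x")
  case True
  let ?D = "orbit' L y (Suc n) x" and ?E = "orbit'' L y (Suc n) x" and ?c = "orbit_cutoff y n x"
  obtain c where c: "(orbit_cutoff y n has_real_derivative c) (at x)"
    "\<bar>c\<bar> \<le> 320 * L / K / (K - 1) * \<bar>?D\<bar>"
    using orbit_cutoff_has_derivative True by metis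
  have D: "1 \<le> \<bar>?D\<bar>" using orbit'_ge_1[OF True] by simp
  have "((\<lambda>x. orbit_cutoff y n x / orbit' L y (Suc n) x) has_real_derivative
      (c * ?D - ?c * ?E) / (?D * ?D)) (at x)"
    using D by (intro DERIV_divide c(1) orbit'_has_derivative) auto
  moreover have "\<bar>(c * ?D - ?c * ?E) / (?D * ?D)\<bar> \<le> 320 * L / K / (K - 1) + 128 * L / K\<^sup>2"
  proof -
    have "\<bar>c * ?D - ?c * ?E\<bar> \<le> \<bar>c\<bar> * \<bar>?D\<bar> + ?c * \<bar>?E\<bar>"
      using orbit_cutoff_range[of y n x]
      by (intro order_trans[OF abs_triangle_ineq4]) (simp add: abs_mult)
    also have "\<dots> \<le> (320 * L / K / (K - 1) * \<bar>?D\<bar>) * \<bar>?D\<bar> + 1 * (128 * L / K\<^sup>2 * ?D\<^sup>2)"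
      using orbit_cutoff_range[of y n x] c(2) distortion[OF True, of "Suc n"] K L
      by (intro add_mono mult_mono) auto
    also have "\<dots> = (320 * L / K / (K - 1) + 128 * L / K\<^sup>2) * \<bar>?D * ?D\<bar>"
      by (simp add: power2_eq_square algebra_simps)
    finally show ?thesis using D by (simp add: abs_divide divide_le_eq)
  qed
  ultimately show ?thesis using that by blast
next
  case False
  have "\<forall>\<^sub>F z in nhds x. orbit_cutoff y n z / orbit' L y (Suc n) z = 0"
    using orbit_cutoff_locally_0(2)[OF False] by eventually_elim simp
  from DERIV_cong_ev[OF refl this refl, of 0]
  have "((\<lambda>x. orbit_cutoff y n x / orbit' L y (Suc n) x) has_real_derivative 0) (at x)" by simp
  then show ?thesis using that K L by fastforce
qed

text \<open>
  At least one kick is required: for \<open>n = 0\<close> the amplitude is identically 1. The last equation also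
  covers the zeros of the derivative, where the left-hand side is 0 by the convention for division
  and the cutoff vanishes.
\<close>

lemma amplitude_bounds:
  assumes "1 \<le> n"
  shows "\<bar>orbit_cutoff y n x / orbit' L y (Suc n) x\<bar> \<le> 1 / (K - 1)"
    "\<bar>orbit_cutoff y n x / orbit' L y (Suc n) x * orbit' L y n x\<bar> \<le> 1 / (K - 1)"
    "orbit_cutoff y n x / orbit' L y (Suc n) x * orbit' L y (Suc n) x = orbit_cutoff y n x"
proof (atomize(full), cases "expanding y n x")
  case True
  let ?D = "orbit' L y (Suc n) x" and ?d = "orbit' L y n x" and ?c = "orbit_cutoff y n x"
  have e: "(K - 1) * \<bar>?d\<bar> \<le> \<bar>?D\<bar>" using expansion[OF True] by simp
  have d: "1 \<le> \<bar>?d\<bar>" "1 \<le> \<bar>?D\<bar>"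
    using orbit'_ge_1[OF True, of "n - 1"] orbit'_ge_1[OF True, of n] assms by auto
  have e': "?c * ((K - 1) * \<bar>?d\<bar>) \<le> 1 * \<bar>?D\<bar>"
    using orbit_cutoff_range[of y n x] e K by (intro mult_mono) auto
  have "?c * ((K - 1) * 1) \<le> ?c * ((K - 1) * \<bar>?d\<bar>)"
    using orbit_cutoff_range[of y n x] d K by (intro mult_left_mono) auto
  with e' have "?c * (K - 1) \<le> \<bar>?D\<bar>" by linarith
  moreover have "?c * ((K - 1) * \<bar>?d\<bar>) \<le> \<bar>?D\<bar>" using e' by simp
  moreover have "?D \<noteq> 0" using d by auto
  ultimately show "\<bar>?c / ?D\<bar> \<le> 1 / (K - 1) \<and> \<bar>?c / ?D * ?d\<bar> \<le> 1 / (K - 1) \<and> ?c / ?D * ?D = ?c"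
    using d K orbit_cutoff_range[of y n x]
    by (simp add: abs_mult divide_le_eq le_divide_eq mult_ac)
next
  case False
  then show "\<bar>orbit_cutoff y n x / orbit' L y (Suc n) x\<bar> \<le> 1 / (K - 1) \<and>
    \<bar>orbit_cutoff y n x / orbit' L y (Suc n) x * orbit' L y n x\<bar> \<le> 1 / (K - 1) \<and>
    orbit_cutoff y n x / orbit' L y (Suc n) x * orbit' L y (Suc n) x = orbit_cutoff y n x"
    using orbit_cutoff_locally_0(1)[OF False] K by simp
qed

text \<open>
  Non-stationary phase. Along the horizontal line the chain rule gives
  \<open>\<Phi>\<^sub>1 = (d\<Phi>/dx - \<Phi>\<^sub>2 \<cdot> orbit'\<^sub>n) / orbit'\<^sub>n\<^sub>+\<^sub>1\<close>. The first term is integrated by parts, with the total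
  derivative falling on the slowly varying amplitude; the second is small because each step expands.
  This replaces any partition of the line into pieces on which the orbit is monotone.
\<close>

lemma oscillatory_integral_bound:
  fixes \<Phi> \<Phi>\<^sub>1 \<Phi>\<^sub>2 :: "real \<times> real \<Rightarrow> real" and g g' :: "real \<Rightarrow> real"
  assumes "1 \<le> n"
    and \<Phi>: "\<And>u. (\<Phi> has_derivative (\<lambda>v. \<Phi>\<^sub>1 u * fst v + \<Phi>\<^sub>2 u * snd v)) (at u)"
    and \<Phi>\<^sub>1: "continuous_on UNIV \<Phi>\<^sub>1"
    and A: "\<And>u. \<bar>\<Phi> u\<bar> \<le> A" and T: "\<And>u. \<bar>\<Phi>\<^sub>2 u\<bar> \<le> T"
    and g: "\<And>x. (g has_real_derivative g' x) (at x)"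
    and B: "\<And>x. \<bar>g x\<bar> \<le> B" and B': "\<And>x. \<bar>g' x\<bar> \<le> B'"
  shows "\<bar>integral {0..1} (\<lambda>x. orbit_cutoff y n x * g x * \<Phi>\<^sub>1 (orbit L y (Suc n) x, orbit L y n x))\<bar>
    \<le> (2 * A * B + A * B' + T * B) / (K - 1) + A * B * (320 * L / K / (K - 1) + 128 * L / K\<^sup>2)"
proof -
  define R where "R = 320 * L / K / (K - 1) + 128 * L / K\<^sup>2"
  define W where "W x = orbit_cutoff y n x / orbit' L y (Suc n) x" for x
  define U where "U x = (orbit L y (Suc n) x, orbit L y n x)" for x
  define H where "H x = orbit_cutoff y n x * g x * \<Phi>\<^sub>1 (U x)" for x
  define P where "P x = W x * g x * \<Phi> (U x)" for x
  have AB: "0 \<le> A" "0 \<le> B" "0 \<le> B'" "0 \<le> T"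
    using A[of undefined] B[of undefined] B'[of undefined] T[of undefined] by linarith+
  have cont_orbit: "continuous_on UNIV (orbit L y k)" for k
    using orbit_has_derivative by (meson DERIV_isCont continuous_at_imp_continuous_on)
  have "continuous_on UNIV (orbit_cutoff y n)"
    by (metis DERIV_isCont continuous_at_imp_continuous_on orbit_cutoff_has_derivative)
  moreover have "continuous_on UNIV g"
    using g by (meson DERIV_isCont continuous_at_imp_continuous_on)
  moreover have "continuous_on UNIV (\<lambda>x. \<Phi>\<^sub>1 (U x))"
    unfolding U_def
    by (rule continuous_on_compose2[OF \<Phi>\<^sub>1]) (auto intro!: continuous_intros cont_orbit)
  ultimately have H: "continuous_on UNIV H"
    unfolding H_def by (intro continuous_intros)
  \<comment> \<open>\<open>P\<close> collects the boundary terms; its derivative is the integrand up to a small error.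
    Comparing \<open>P\<close> with the primitive of the integrand by the mean value inequality
    spares the integrability of that error.\<close>
  have step: "\<exists>p. (P has_real_derivative p) (at x) \<and> \<bar>H x - p\<bar> \<le> (A * B' + T * B) / (K - 1) + A * B * R"
    for x
  proof -
    obtain w where w: "(W has_real_derivative w) (at x)" "\<bar>w\<bar> \<le> R"
      unfolding W_def R_def by (rule amplitude_has_derivative)
    have "(U has_derivative (\<lambda>h. (orbit' L y (Suc n) x * h, orbit' L y n x * h))) (at x)"
      unfolding U_def
      by (intro has_derivative_Pair) (use orbit_has_derivative in \<open>auto simp: has_field_derivative_def\<close>)
    from has_derivative_compose[OF this \<Phi>]
    have "((\<lambda>x. \<Phi> (U x)) has_real_derivative
        \<Phi>\<^sub>1 (U x) * orbit' L y (Suc n) x + \<Phi>\<^sub>2 (U x) * orbit' L y n x) (at x)"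
      unfolding has_field_derivative_def by (rule has_derivative_eq_rhs) (simp add: fun_eq_iff algebra_simps)
    from DERIV_mult[OF DERIV_mult[OF w(1) g] this]
    have "(P has_real_derivative (w * g x + g' x * W x) * \<Phi> (U x) +
        (\<Phi>\<^sub>1 (U x) * orbit' L y (Suc n) x + \<Phi>\<^sub>2 (U x) * orbit' L y n x) * (W x * g x)) (at x)"
      unfolding P_def .
    moreover have "\<bar>H x - ((w * g x + g' x * W x) * \<Phi> (U x) +
        (\<Phi>\<^sub>1 (U x) * orbit' L y (Suc n) x + \<Phi>\<^sub>2 (U x) * orbit' L y n x) * (W x * g x))\<bar>
        \<le> (A * B' + T * B) / (K - 1) + A * B * R"
    proof -
      have H_eq: "H x = \<Phi>\<^sub>1 (U x) * orbit' L y (Suc n) x * (W x * g x)"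
        unfolding H_def W_def
        by (subst amplitude_bounds(3)[OF assms(1), of y x, symmetric]) (simp only: mult_ac)
      have "\<bar>H x - ((w * g x + g' x * W x) * \<Phi> (U x) +
        (\<Phi>\<^sub>1 (U x) * orbit' L y (Suc n) x + \<Phi>\<^sub>2 (U x) * orbit' L y n x) * (W x * g x))\<bar>
        = \<bar>w * (g x * \<Phi> (U x)) + W x * (g' x * \<Phi> (U x)) + (W x * orbit' L y n x) * (\<Phi>\<^sub>2 (U x) * g x)\<bar>"
        unfolding H_eq by (subst abs_minus_cancel[symmetric]) (simp add: algebra_simps)
      also have "\<dots> \<le> \<bar>w\<bar> * (\<bar>g x\<bar> * \<bar>\<Phi> (U x)\<bar>) + \<bar>W x\<bar> * (\<bar>g' x\<bar> * \<bar>\<Phi> (U x)\<bar>)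
          + \<bar>W x * orbit' L y n x\<bar> * (\<bar>\<Phi>\<^sub>2 (U x)\<bar> * \<bar>g x\<bar>)"
        by (intro order_trans[OF abs_triangle_ineq] add_mono) (simp_all add: abs_mult)
      also have "\<dots> \<le> R * (B * A) + 1 / (K - 1) * (B' * A) + 1 / (K - 1) * (T * B)"
        using amplitude_bounds(1,2)[OF assms(1), of y x] w(2) A B B' T AB K
        unfolding W_def[symmetric] by (intro add_mono mult_mono) auto
      also have "\<dots> = (A * B' + T * B) / (K - 1) + A * B * R" by (simp add: add_divide_distrib mult_ac)
      finally show ?thesis .
    qed
    ultimately show ?thesis by blast
  qed
  then obtain p where p: "\<And>x. (P has_real_derivative p x) (at x)"
    "\<And>x. \<bar>H x - p x\<bar> \<le> (A * B' + T * B) / (K - 1) + A * B * R" by metis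
  have "norm ((primitive H 1 - P 1) - (primitive H 0 - P 0))
      \<le> ((A * B' + T * B) / (K - 1) + A * B * R) * norm (1 - 0 :: real)"
    by (rule field_differentiable_bound[of UNIV _ "\<lambda>x. H x - p x"])
      (use p in \<open>auto intro!: DERIV_diff primitive_has_derivative[OF H]\<close>)
  then have "\<bar>primitive H 1\<bar> \<le> (A * B' + T * B) / (K - 1) + A * B * R + \<bar>P 1\<bar> + \<bar>P 0\<bar>" by auto
  moreover have "\<bar>P x\<bar> \<le> A * B / (K - 1)" for x
  proof -
    have "\<bar>W x\<bar> * \<bar>g x\<bar> * \<bar>\<Phi> (U x)\<bar> \<le> 1 / (K - 1) * B * A"
      using amplitude_bounds(1)[OF assms(1), of y x] A B AB K
      unfolding W_def[symmetric] by (intro mult_mono) auto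
    then show ?thesis by (simp add: P_def abs_mult mult_ac)
  qed
  from this[of 0] this[of 1] have "\<bar>P 0\<bar> + \<bar>P 1\<bar> \<le> 2 * A * B / (K - 1)" by simp
  ultimately have "\<bar>primitive H 1\<bar> \<le> (2 * A * B + A * B' + T * B) / (K - 1) + A * B * R"
    by (simp add: add_divide_distrib)
  moreover have "integral {0..1} H = primitive H 1"
    using primitive_eq_integral[OF H, of 0 1] by simp
  moreover have "H = (\<lambda>x. orbit_cutoff y n x * g x * \<Phi>\<^sub>1 (orbit L y (Suc n) x, orbit L y n x))"
    by (simp add: fun_eq_iff H_def U_def)
  ultimately show ?thesis by (simp add: R_def)
qed

end

section \<open>Invariance of Lebesgue measure and the mass of the cutoff\<close>

definition unit_square_integral :: "(real \<times> real \<Rightarrow> real) \<Rightarrow> real" where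
  "unit_square_integral H = integral (cbox (0, 0) (1, 1)) H"

lemma unit_square_integral_iterated:
  assumes "continuous_on UNIV H"
  shows "unit_square_integral H = integral {0..1} (\<lambda>x. integral {0..1} (\<lambda>y. H (x, y)))"
    "unit_square_integral H = integral {0..1} (\<lambda>y. integral {0..1} (\<lambda>x. H (x, y)))"
proof -
  have H: "continuous_on (cbox (0, 0) (1, 1)) H" using assms continuous_on_subset by blast
  from integral_prod_continuous[OF this]
  show 1: "unit_square_integral H = integral {0..1} (\<lambda>x. integral {0..1} (\<lambda>y. H (x, y)))"
    by (simp add: unit_square_integral_def)
  show "unit_square_integral H = integral {0..1} (\<lambda>y. integral {0..1} (\<lambda>x. H (x, y)))"
    using integral_swap_continuous[of 0 0 1 1 "\<lambda>x y. H (x, y)"] H unfolding 1 by simp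
qed

lemma unit_square_integrable: "continuous_on UNIV H \<Longrightarrow> H integrable_on cbox (0, 0) (1, 1)"
  for H :: "real \<times> real \<Rightarrow> real"
  by (rule integrable_continuous) (use continuous_on_subset in blast)

definition doubly_periodic :: "(real \<times> real \<Rightarrow> real) \<Rightarrow> bool" where
  "doubly_periodic H \<longleftrightarrow> continuous_on UNIV H \<and>
    (\<forall>x y. H (x + 1, y) = H (x, y)) \<and> (\<forall>x y. H (x, y + 1) = H (x, y))"

text \<open>
  The map in the plane that the standard map lifts to. Its iterates on a horizontal line are the
  orbits above, and \<open>doubly_periodic\<close> functions are the lifts of continuous functions on the torus.
\<close>

definition lifted_map :: "real \<Rightarrow> real \<times> real \<Rightarrow> real \<times> real" where
  "lifted_map L u = (kick L (fst u) - snd u, fst u)"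

lemma lifted_map_funpow:
  "(lifted_map L ^^ n) (x, y) = (orbit L y (Suc n) x, orbit L y n x)"
  by (induction n) (simp_all add: lifted_map_def)

lemma continuous_on_kick: "continuous_on S (kick L)"
  unfolding kick_def by (intro continuous_intros)

lemma continuous_on_lifted_map_funpow: "continuous_on UNIV (lifted_map L ^^ n)"
proof (induction n)
  case 0
  show ?case by (simp add: id_def)
next
  case (Suc n)
  have "continuous_on UNIV (lifted_map L)"
    unfolding lifted_map_def
    by (intro continuous_intros continuous_on_compose2[OF continuous_on_kick]) auto
  then show ?case unfolding funpow.simps
    using Suc continuous_on_compose continuous_on_subset subset_UNIV by metis
qed

lemma kick_plus_1: "kick L (x + 1) = kick L x + 1 + 1"
proof -
  have "sin (2 * pi * (x + 1)) = sin (2 * pi * x + 2 * pi)" by (simp add: algebra_simps)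
  also have "\<dots> = sin (2 * pi * x)" by (rule sin_periodic)
  finally show ?thesis by (simp add: kick_def algebra_simps del: sin_periodic)
qed

lemma doubly_periodic_lifted_map:
  assumes "doubly_periodic H"
  shows "doubly_periodic (\<lambda>u. H (lifted_map L u))"
proof -
  have p: "H (x + 1, y) = H (x, y)" "H (x, y + 1) = H (x, y)" for x y
    using assms by (auto simp: doubly_periodic_def)
  have "H (x + 1 + 1 - y, z + 1) = H (x - y, z)" for x y z
  proof -
    have "x + 1 + 1 - y = x - y + 1 + 1" by simp
    then show ?thesis by (simp only: p)
  qed
  moreover have "H (x - (y + 1), z) = H (x - y, z)" for x y z
    using p(1)[of "x - (y + 1)" z] by simp
  moreover have "continuous_on UNIV (\<lambda>u. H (lifted_map L u))"
    using continuous_on_compose2[of UNIV H UNIV "lifted_map L"] assms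
      continuous_on_lifted_map_funpow[where L = L and n = 1]
    by (simp add: doubly_periodic_def)
  ultimately show ?thesis by (simp add: doubly_periodic_def lifted_map_def kick_plus_1)
qed

text \<open>
  Invariance of Lebesgue measure. For fixed \<open>x\<close> the first coordinate of the image is a reflected
  translate of \<open>y\<close>, which does not change the mean of a periodic function; Fubini does the rest.
\<close>

lemma unit_square_integral_lifted_map:
  assumes "doubly_periodic H"
  shows "unit_square_integral (\<lambda>u. H (lifted_map L u)) = unit_square_integral H"
proof -
  have H: "continuous_on UNIV H" using assms by (simp add: doubly_periodic_def)
  have "unit_square_integral (\<lambda>u. H (lifted_map L u)) =
      integral {0..1} (\<lambda>x. integral {0..1} (\<lambda>y. H (kick L x - y, x)))"
    using doubly_periodic_lifted_map[OF assms]
    by (subst unit_square_integral_iterated(1)) (auto simp: doubly_periodic_def lifted_map_def)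
  also have "\<dots> = integral {0..1} (\<lambda>x. integral {0..1} (\<lambda>s. H (s, x)))"
  proof (rule Henstock_Kurzweil_Integration.integral_cong)
    show "integral {0..1} (\<lambda>y. H (kick L x - y, x)) = integral {0..1} (\<lambda>s. H (s, x))" for x
      using assms
      by (intro integral_periodic_reflect continuous_on_compose2[OF H] continuous_intros)
        (auto simp: doubly_periodic_def)
  qed
  also have "\<dots> = unit_square_integral H" by (rule unit_square_integral_iterated(2)[OF H, symmetric])
  finally show ?thesis .
qed

lemma
  assumes "doubly_periodic H"
  shows doubly_periodic_funpow: "doubly_periodic (\<lambda>u. H ((lifted_map L ^^ n) u))"
    and unit_square_integral_funpow:
      "unit_square_integral (\<lambda>u. H ((lifted_map L ^^ n) u)) = unit_square_integral H"
proof -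
  have "doubly_periodic (\<lambda>u. H ((lifted_map L ^^ n) u)) \<and>
      unit_square_integral (\<lambda>u. H ((lifted_map L ^^ n) u)) = unit_square_integral H"
  proof (induction n)
    case (Suc n)
    have eq: "(\<lambda>u. H ((lifted_map L ^^ Suc n) u)) = (\<lambda>u. H ((lifted_map L ^^ n) (lifted_map L u)))"
      unfolding funpow_Suc_right o_apply ..
    show ?case
      unfolding eq
      using Suc doubly_periodic_lifted_map[where H = "\<lambda>u. H ((lifted_map L ^^ n) u)" and L = L]
        unit_square_integral_lifted_map[where H = "\<lambda>u. H ((lifted_map L ^^ n) u)" and L = L]
      by metis
  qed (use assms in simp)
  then show "doubly_periodic (\<lambda>u. H ((lifted_map L ^^ n) u))"
    "unit_square_integral (\<lambda>u. H ((lifted_map L ^^ n) u)) = unit_square_integral H" by auto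
qed

lemma torus_proj_shift:
  "torus_proj (x + 1, y) = torus_proj (x, y)" "torus_proj (x, y + 1) = torus_proj (x, y)"
  by (simp_all add: torus_proj_eq_iff lattice_rel_def)

lemma standard_map_funpow_proj:
  "(standard_map L ^^ n) (torus_proj u) = torus_proj ((lifted_map L ^^ n) u)"
proof (induction n)
  case (Suc n)
  then show ?case
    by (simp add: standard_map.abs_eq lifted_map_def kick_def case_prod_unfold)
qed simp

text \<open>
  The flat metric induces the quotient topology: close points of the torus have close lifts, and one
  of the two lifts can be prescribed.
\<close>

lemma continuous_on_torus:
  fixes h :: "torus2 \<Rightarrow> real"
  assumes "continuous_on UNIV (\<lambda>u. h (torus_proj u))"
  shows "continuous_on UNIV h"
  unfolding continuous_on_iff
proof (intro ballI allI impI)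
  fix p :: torus2 and e :: real assume "0 < e"
  define u where "u = torus_rep p"
  obtain d where d: "0 < d" "\<And>v. dist v u < d \<Longrightarrow> dist (h (torus_proj v)) (h (torus_proj u)) < e"
    using assms \<open>0 < e\<close> unfolding continuous_on_iff by (metis UNIV_I)
  have "dist (h q) (h p) < e" if close: "dist q p < d" for q
  proof -
    obtain v w where vw: "torus_proj v = q" "torus_proj w = p" "dist v w < d"
      using dist_torus2_less[OF close] by blast
    have "lattice_rel w u" using vw(2) by (simp add: u_def flip: torus_proj_eq_iff)
    then have "lattice_rel (v + (u - w)) v"
      unfolding lattice_rel_def by (auto dest: Ints_minus)
    then have "torus_proj (v + (u - w)) = q" using vw(1) torus_proj_eq_iff by metis
    moreover have "dist (v + (u - w)) u < d" using vw(3) by (simp add: dist_norm algebra_simps)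
    ultimately show ?thesis using d(2)[of "v + (u - w)"] by (simp add: u_def)
  qed
  then show "\<exists>d>0. \<forall>q\<in>UNIV. dist q p < d \<longrightarrow> dist (h q) (h p) < e" using d(1) by blast
qed

lemma integral_torus_measure:
  fixes h :: "torus2 \<Rightarrow> real"
  assumes cont: "continuous_on UNIV (\<lambda>u. h (torus_proj u))"
  shows "(\<integral>p. h p \<partial>torus_measure) = unit_square_integral (\<lambda>u. h (torus_proj u))"
proof -
  let ?Q = "{0..<1} \<times> {0..<1} :: (real \<times> real) set"
  let ?h = "\<lambda>u. h (torus_proj u)"
  have box: "box (0, 0) (1, 1) \<subseteq> ?Q" "?Q \<subseteq> cbox (0, 0) (1, 1)"
    by (auto simp: box_def Basis_prod_def inner_Pair cbox_Pair_eq)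
  have Q: "?Q \<in> sets lborel" by (auto intro!: pair_measureI simp flip: lborel_prod)
  have "h \<in> borel_measurable borel"
    by (intro borel_measurable_continuous_onI continuous_on_torus cont)
  then have "(\<integral>p. h p \<partial>torus_measure) = (\<integral>u. ?h u \<partial>restrict_space lborel ?Q)"
    unfolding torus_measure_def
    by (intro integral_distr measurable_restrict_space1) simp_all
  also have "\<dots> = (LINT u : ?Q | lborel. ?h u)"
    unfolding set_lebesgue_integral_def using Q by (intro integral_restrict_space) simp
  also have "\<dots> = integral ?Q ?h"
  proof (rule set_borel_integral_eq_integral)
    have "set_integrable lborel (cbox (0, 0) (1, 1)) ?h"
      unfolding set_integrable_def
      by (rule borel_integrable_compact) (use cont continuous_on_subset in auto)
    then show "set_integrable lborel ?Q ?h"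
      by (rule set_integrable_subset) (use Q box in auto)
  qed
  also have "\<dots> = integral (cbox (0, 0) (1, 1)) ?h"
  proof (rule integral_spike_set)
    show "negligible {x \<in> ?Q - cbox (0, 0) (1, 1). ?h x \<noteq> 0}"
      using box by (intro negligible_subset[OF negligible_empty]) auto
    show "negligible {x \<in> cbox (0, 0) (1, 1) - ?Q. ?h x \<noteq> 0}"
      using box by (intro negligible_subset[OF negligible_frontier_interval[of "(0, 0)" "(1, 1)"]]) auto
  qed
  finally show ?thesis by (simp add: unit_square_integral_def)
qed

context strong_kick
begin

lemma continuous_on_cutoff: "continuous_on UNIV cutoff"
  by (metis DERIV_isCont continuous_at_imp_continuous_on cutoff_has_derivative)

text \<open>
  A rational majorant of the excluded weight, chosen because it can be integrated explicitly.
\<close>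

lemma cutoff_complement_bound: "1 - cutoff x \<le> 4 * K\<^sup>2 / (K\<^sup>2 + (kick' L x)\<^sup>2)"
proof -
  define g where "g = kick' L x"
  define m where "m = max 0 (g\<^sup>2 - K\<^sup>2)"
  have pos: "0 < K\<^sup>2 + g\<^sup>2" "0 < m\<^sup>2 + K ^ 4" using K denominator_pos by (auto intro: add_pos_nonneg)
  have "1 - cutoff x = K ^ 4 / (m\<^sup>2 + K ^ 4)"
    using pos by (simp add: cutoff_def g_def[symmetric] m_def[symmetric] field_simps)
  also have "\<dots> \<le> 4 * K\<^sup>2 / (K\<^sup>2 + g\<^sup>2)"
  proof (cases "m = 0")
    case True
    then have "g\<^sup>2 \<le> K\<^sup>2" by (auto simp: m_def max_def split: if_splits)
    then have "K\<^sup>2 + g\<^sup>2 \<le> 4 * K\<^sup>2" using zero_le_power2[of K] by linarith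
    then show ?thesis using True K pos by (simp add: le_divide_eq)
  next
    case False
    then have g: "g\<^sup>2 = m + K\<^sup>2" and "0 \<le> m" by (auto simp: m_def max_def split: if_splits)
    have "K ^ 4 * (K\<^sup>2 + g\<^sup>2) = K\<^sup>2 * (K\<^sup>2 * m + 2 * K ^ 4)"
      unfolding g by (simp add: algebra_simps power2_eq_square power4_eq_xxxx)
    also have "\<dots> \<le> K\<^sup>2 * (4 * (m\<^sup>2 + K ^ 4))"
    proof (intro mult_left_mono)
      have "2 * (K\<^sup>2 * m) \<le> m\<^sup>2 + K ^ 4"
        using sum_squares_bound[of m "K\<^sup>2"] by (simp add: mult_ac)
      moreover have "0 \<le> K ^ 4" by simp
      ultimately show "K\<^sup>2 * m + 2 * K ^ 4 \<le> 4 * (m\<^sup>2 + K ^ 4)"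
        using zero_le_power2[of m] by (simp only: distrib_left)
    qed simp
    finally have "K ^ 4 * (K\<^sup>2 + g\<^sup>2) \<le> 4 * K\<^sup>2 * (m\<^sup>2 + K ^ 4)" by (simp only: mult_ac)
    then show ?thesis using pos by (subst frac_le_eq) (auto simp: divide_le_0_iff algebra_simps)
  qed
  finally show ?thesis by (simp add: g_def)
qed

text \<open>
  Near the critical points of the kick, where the majorant is of order 1, \<open>\<bar>sin\<bar>\<close> is close to 1; as
  \<open>kick''\<close> is a multiple of \<open>sin\<close>, the majorant times \<open>\<bar>sin\<bar>\<close> is up to the factor \<open>K / L\<close> the
  derivative of \<open>arctan (kick' / K)\<close>, a bounded function. What remains after \<open>1 = sin\<^sup>2 + cos\<^sup>2\<close> is the
  part with \<open>cos\<^sup>2\<close>, which is at most of order \<open>(K\<^sup>2 + kick'\<^sup>2) / L\<^sup>2\<close> and cancels the denominator.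
  The sign \<open>\<sigma>\<close> removes the absolute value of \<open>sin\<close>.
\<close>

lemma integral_cutoff_complement_half:
  assumes "K \<le> L" "a \<le> b" and \<sigma>: "\<bar>\<sigma>\<bar> = 1"
    and sin: "\<And>x. x \<in> {a..b} \<Longrightarrow> 0 \<le> \<sigma> * sin (2 * pi * x)"
  shows "integral {a..b} (\<lambda>x. 1 - cutoff x) \<le> (4 * (b - a) + 1) * K / L"
proof -
  have "0 < L" using assms(1) K by simp
  define G where "G x = 4 * (K\<^sup>2 / L\<^sup>2 * x - \<sigma> * (K / (4 * pi\<^sup>2 * L) * arctan (kick' L x / K)))" for x
  define q where "q x = K\<^sup>2 / (K\<^sup>2 + (kick' L x)\<^sup>2)" for x
  have pos: "0 < K\<^sup>2 + (kick' L x)\<^sup>2" for x using K by (intro add_pos_nonneg) auto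
  have der: "(G has_real_derivative 4 * (K\<^sup>2 / L\<^sup>2 + \<sigma> * sin (2 * pi * x) * q x)) (at x)" for x
  proof -
    have "((\<lambda>x. kick' L x / K) has_real_derivative kick'' L x / K) (at x)"
      by (intro DERIV_cdivide kick'_has_derivative)
    from DERIV_chain2[OF DERIV_arctan this]
    have "((\<lambda>x. arctan (kick' L x / K)) has_real_derivative
        inverse (1 + (kick' L x / K)\<^sup>2) * (kick'' L x / K)) (at x)" .
    moreover have "inverse (1 + (kick' L x / K)\<^sup>2) = q x"
      using K pos[of x] by (simp add: q_def field_simps)
    ultimately have "((\<lambda>x. arctan (kick' L x / K)) has_real_derivative q x * (kick'' L x / K)) (at x)"
      by simp
    then have "(G has_real_derivative 4 * (K\<^sup>2 / L\<^sup>2 * 1 -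
        \<sigma> * (K / (4 * pi\<^sup>2 * L) * (q x * (kick'' L x / K))))) (at x)"
      unfolding G_def by (intro DERIV_cmult DERIV_diff DERIV_ident)
    then show ?thesis
      using K \<open>0 < L\<close> by (simp add: kick''_def mult_ac)
  qed
  have "integral {a..b} (\<lambda>x. 1 - cutoff x) \<le> G b - G a"
  proof (rule has_integral_le)
    show "((\<lambda>x. 1 - cutoff x) has_integral integral {a..b} (\<lambda>x. 1 - cutoff x)) {a..b}"
      by (intro integrable_integral integrable_continuous_real continuous_intros
          continuous_on_subset[OF continuous_on_cutoff]) auto
    show "((\<lambda>x. 4 * (K\<^sup>2 / L\<^sup>2 + \<sigma> * sin (2 * pi * x) * q x)) has_integral G b - G a) {a..b}"
      by (intro fundamental_theorem_of_calculus assms(2))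
        (use der in \<open>auto simp: has_real_derivative_iff_has_vector_derivative[symmetric] intro: DERIV_subset\<close>)
    fix x assume x: "x \<in> {a..b}"
    define s where "s = sin (2 * pi * x)"
    define c where "c = cos (2 * pi * x)"
    have "0 \<le> q x" using pos[of x] by (simp add: q_def)
    have "s\<^sup>2 \<le> \<sigma> * s"
    proof -
      have "\<bar>s\<bar> * \<bar>s\<bar> \<le> \<bar>s\<bar> * 1" by (intro mult_left_mono) (auto simp: s_def)
      moreover have "\<bar>s\<bar> = \<sigma> * s"
        using sin[OF x] \<sigma> unfolding s_def by (metis abs_mult abs_of_nonneg mult_1)
      ultimately show ?thesis by (metis abs_mult_self_eq mult.right_neutral power2_eq_square)
    qed
    then have "s\<^sup>2 * q x \<le> \<sigma> * s * q x" using \<open>0 \<le> q x\<close> by (rule mult_right_mono)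
    moreover have "c\<^sup>2 * q x \<le> K\<^sup>2 / L\<^sup>2"
    proof -
      define g where "g = kick' L x"
      have "2 * pi * L * c = g - 2" by (simp add: g_def kick'_def c_def)
      then have "4 * pi\<^sup>2 * (L\<^sup>2 * c\<^sup>2) = (g - 2)\<^sup>2"
        by (simp add: power_mult_distrib mult_ac flip: \<open>2 * pi * L * c = g - 2\<close>)
      also have "\<dots> \<le> 2 * g\<^sup>2 + 8"
        using zero_le_power2[of "g + 2"] by (simp add: power2_eq_square algebra_simps)
      finally have "4 * pi\<^sup>2 * (L\<^sup>2 * c\<^sup>2) \<le> 2 * g\<^sup>2 + 8" .
      moreover have "36 * (L\<^sup>2 * c\<^sup>2) \<le> 4 * pi\<^sup>2 * (L\<^sup>2 * c\<^sup>2)"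
        using power_mono[of 3 pi 2] pi_gt3 by (intro mult_right_mono) auto
      moreover have "36 \<le> K\<^sup>2" using power_mono[of 6 K 2] K by simp
      ultimately have "L\<^sup>2 * c\<^sup>2 \<le> K\<^sup>2 + g\<^sup>2" using zero_le_power2[of g] by linarith
      then have "K\<^sup>2 * (L\<^sup>2 * c\<^sup>2) \<le> K\<^sup>2 * (K\<^sup>2 + g\<^sup>2)" by (intro mult_left_mono) auto
      then show ?thesis
        using pos[of x] \<open>0 < L\<close> unfolding q_def g_def[symmetric]
        by (simp add: divide_le_eq le_divide_eq mult_ac)
    qed
    moreover have "q x = s\<^sup>2 * q x + c\<^sup>2 * q x"
      by (simp add: s_def c_def flip: distrib_right)
    ultimately have "q x \<le> K\<^sup>2 / L\<^sup>2 + \<sigma> * s * q x" by linarith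
    then show "1 - cutoff x \<le> 4 * (K\<^sup>2 / L\<^sup>2 + \<sigma> * sin (2 * pi * x) * q x)"
      using cutoff_complement_bound[of x] by (simp add: q_def s_def)
  qed
  also have "G b - G a = 4 * (b - a) * (K\<^sup>2 / L\<^sup>2)
      + \<sigma> * (K / (pi\<^sup>2 * L)) * (arctan (kick' L a / K) - arctan (kick' L b / K))"
    by (simp add: G_def algebra_simps)
  also have "\<dots> \<le> 4 * (b - a) * (K / L) + K / L"
  proof (rule add_mono)
    have "K * K \<le> K * L" using assms(1) K by (intro mult_left_mono) auto
    then have "K\<^sup>2 / L\<^sup>2 \<le> K / L" using \<open>0 < L\<close> by (simp add: power2_eq_square field_simps)
    then show "4 * (b - a) * (K\<^sup>2 / L\<^sup>2) \<le> 4 * (b - a) * (K / L)"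
      using assms(2) by (intro mult_left_mono) auto
    have "\<bar>arctan (kick' L a / K) - arctan (kick' L b / K)\<bar> \<le> pi"
      using arctan_bounded[of "kick' L a / K"] arctan_bounded[of "kick' L b / K"] by (simp add: abs_le_iff)
    then have "\<bar>\<sigma> * (K / (pi\<^sup>2 * L)) * (arctan (kick' L a / K) - arctan (kick' L b / K))\<bar>
        \<le> 1 * (K / (pi\<^sup>2 * L)) * pi"
      using \<sigma> K \<open>0 < L\<close> unfolding abs_mult by (intro mult_mono) auto
    also have "\<dots> = K / L / pi" by (simp add: power2_eq_square)
    also have "\<dots> \<le> K / L / 1" using pi_gt3 K \<open>0 < L\<close> by (intro divide_left_mono) auto
    finally show "\<sigma> * (K / (pi\<^sup>2 * L)) * (arctan (kick' L a / K) - arctan (kick' L b / K)) \<le> K / L"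
      by (metis abs_le_D1 div_by_1)
  qed
  finally show ?thesis by (simp add: algebra_simps add_divide_distrib diff_divide_distrib)
qed

lemma integral_cutoff_complement:
  assumes "K \<le> L"
  shows "integral {0..1} (\<lambda>x. 1 - cutoff x) \<le> 6 * K / L"
proof -
  have "(\<lambda>x. 1 - cutoff x) integrable_on {0..1}"
    by (intro integrable_continuous_real continuous_intros
        continuous_on_subset[OF continuous_on_cutoff]) auto
  from Henstock_Kurzweil_Integration.integral_combine[of 0 "1/2" 1, OF _ _ this]
  have "integral {0..1} (\<lambda>x. 1 - cutoff x) =
      integral {0..1/2} (\<lambda>x. 1 - cutoff x) + integral {1/2..1} (\<lambda>x. 1 - cutoff x)" by simp
  also have "\<dots> \<le> (4 * (1/2 - 0) + 1) * K / L + (4 * (1 - 1/2) + 1) * K / L"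
  proof (rule add_mono)
    show "integral {0..1/2} (\<lambda>x. 1 - cutoff x) \<le> (4 * (1/2 - 0) + 1) * K / L"
    proof (rule integral_cutoff_complement_half[OF assms, where \<sigma> = 1])
      fix x :: real assume "x \<in> {0..1/2}"
      then have "0 \<le> sin (2 * pi * x)" by (intro sin_ge_zero) (auto simp: field_simps)
      then show "0 \<le> 1 * sin (2 * pi * x)" by simp
    qed auto
    show "integral {1/2..1} (\<lambda>x. 1 - cutoff x) \<le> (4 * (1 - 1/2) + 1) * K / L"
    proof (rule integral_cutoff_complement_half[OF assms, where \<sigma> = "-1"])
      fix x :: real assume "x \<in> {1/2..1}"
      then have "0 \<le> sin (2 * pi * x - pi)" by (intro sin_ge_zero) (auto simp: field_simps)
      then show "0 \<le> -1 * sin (2 * pi * x)" by (simp add: sin_diff)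
    qed auto
  qed
  finally show ?thesis by simp
qed

text \<open>
  By invariance every iterate loses the same mass, and the losses add up at most linearly. This is
  the origin of the factor \<open>n\<close> in the final estimate.
\<close>

lemma continuous_on_orbit_cutoff: "continuous_on UNIV (\<lambda>u. orbit_cutoff (snd u) n (fst u))"
  and orbit_cutoff_mass:
    "unit_square_integral (\<lambda>u. 1 - orbit_cutoff (snd u) n (fst u))
      \<le> real n * integral {0..1} (\<lambda>x. 1 - cutoff x)"
proof -
  define I where "I = integral {0..1} (\<lambda>x. 1 - cutoff x)"
  define c where "c k u = cutoff (fst ((lifted_map L ^^ k) u))" for k and u :: "real \<times> real"
  have per: "doubly_periodic (\<lambda>u. 1 - cutoff (fst u))"
  proof -
    have "kick' L (x + 1) = kick' L x" for x
    proof -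
      have "cos (2 * pi * (x + 1)) = cos (2 * pi * x + 2 * pi)" by (simp add: algebra_simps)
      then show ?thesis by (simp add: kick'_def)
    qed
    then have "cutoff (x + 1) = cutoff x" for x by (simp add: cutoff_def)
    moreover have "continuous_on UNIV (\<lambda>u :: real \<times> real. 1 - cutoff (fst u))"
      by (intro continuous_intros continuous_on_compose2[OF continuous_on_cutoff]) auto
    ultimately show ?thesis by (simp add: doubly_periodic_def)
  qed
  have cc: "continuous_on UNIV (\<lambda>u. 1 - c k u)" for k
    unfolding c_def using doubly_periodic_funpow[OF per, where L = L and n = k] by (simp add: doubly_periodic_def)
  have mass: "unit_square_integral (\<lambda>u. 1 - c k u) = I" for k
  proof -
    have "unit_square_integral (\<lambda>u. 1 - c k u) = unit_square_integral (\<lambda>u. 1 - cutoff (fst u))"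
      unfolding c_def by (rule unit_square_integral_funpow[OF per])
    also have "\<dots> = I"
      using unit_square_integral_iterated(2)[of "\<lambda>u. 1 - cutoff (fst u)"] per
      by (simp add: doubly_periodic_def I_def)
    finally show ?thesis .
  qed
  have Suc: "orbit_cutoff (snd u) (Suc k) (fst u) = orbit_cutoff (snd u) k (fst u) * c k u" for k u
    using lifted_map_funpow[of k L "fst u" "snd u"] by (simp add: orbit_cutoff_def c_def)
  have "continuous_on UNIV (\<lambda>u. orbit_cutoff (snd u) n (fst u)) \<and>
    unit_square_integral (\<lambda>u. 1 - orbit_cutoff (snd u) n (fst u)) \<le> real n * I"
  proof (induction n)
    case 0
    show ?case by (simp add: orbit_cutoff_def unit_square_integral_def)
  next
    case (Suc n)
    have ck: "continuous_on UNIV (c n)" using continuous_on_diff[OF continuous_on_const cc[of n], of 1] by simp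
    have cont: "continuous_on UNIV (\<lambda>u. orbit_cutoff (snd u) (Suc n) (fst u))"
      unfolding \<open>\<And>u k. orbit_cutoff (snd u) (Suc k) (fst u) = _\<close>
      using Suc ck by (intro continuous_intros) auto
    have "unit_square_integral (\<lambda>u. 1 - orbit_cutoff (snd u) (Suc n) (fst u))
       \<le> unit_square_integral (\<lambda>u. (1 - orbit_cutoff (snd u) n (fst u)) + (1 - c n u))"
      unfolding unit_square_integral_def
    proof (rule integral_le)
      show "1 - orbit_cutoff (snd u) (Suc n) (fst u) \<le> (1 - orbit_cutoff (snd u) n (fst u)) + (1 - c n u)" for u
      proof -
        have "0 \<le> (1 - orbit_cutoff (snd u) n (fst u)) * (1 - c n u)"
          using orbit_cutoff_range cutoff_range by (simp add: c_def)
        then show ?thesis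
          unfolding \<open>\<And>u k. orbit_cutoff (snd u) (Suc k) (fst u) = _\<close> by (simp add: algebra_simps)
      qed
    qed (use cont ck Suc in \<open>auto intro!: unit_square_integrable continuous_intros\<close>)
    also have "\<dots> = unit_square_integral (\<lambda>u. 1 - orbit_cutoff (snd u) n (fst u)) + I"
      unfolding mass[of n, symmetric] unit_square_integral_def
      using ck Suc by (intro Henstock_Kurzweil_Integration.integral_add unit_square_integrable continuous_intros) auto
    also have "\<dots> \<le> real (Suc n) * I" using Suc by (simp add: algebra_simps)
    finally show ?case using cont by blast
  qed
  then show "continuous_on UNIV (\<lambda>u. orbit_cutoff (snd u) n (fst u))"
    "unit_square_integral (\<lambda>u. 1 - orbit_cutoff (snd u) n (fst u))
      \<le> real n * integral {0..1} (\<lambda>x. 1 - cutoff x)" by (auto simp: I_def)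
qed

end

section \<open>Decay of correlations\<close>

context strong_kick
begin

text \<open>
  On each horizontal line the two observables are replaced by averages over length \<^term>\<open>\<epsilon>\<close>, and the
  orbit is restricted to the expanding points. The mollified integral is then purely oscillatory; the
  price is \<open>\<epsilon> powr \<alpha>\<close> for the mollification, derivatives of order \<open>1 / \<epsilon>\<close>, and the mass of the cutoff.
\<close>

lemma zero_mean_correlation_bound:
  fixes \<phi> \<psi> :: "real \<times> real \<Rightarrow> real"
  assumes "1 \<le> n" "K \<le> L" "0 < \<epsilon>" "0 < \<alpha>"
    and \<phi>: "doubly_periodic \<phi>" and \<psi>: "doubly_periodic \<psi>"
    and mean: "\<And>y. integral {0..1} (\<lambda>s. \<phi> (s, y)) = 0"
    and A: "\<And>u. \<bar>\<phi> u\<bar> \<le> A"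
    and A_hol: "\<And>s y y'. \<bar>\<phi> (s, y) - \<phi> (s, y')\<bar> \<le> A * \<bar>y - y'\<bar> powr \<alpha>"
    and B: "\<And>u. \<bar>\<psi> u\<bar> \<le> B"
    and B_hol: "\<And>x x' y. \<bar>\<psi> (x, y) - \<psi> (x', y)\<bar> \<le> B * \<bar>x - x'\<bar> powr \<alpha>"
  shows "\<bar>unit_square_integral (\<lambda>u. \<phi> ((lifted_map L ^^ n) u) * \<psi> u)\<bar>
    \<le> A * B * (real n * (6 * K / L) + 2 * \<epsilon> powr \<alpha> + (2 + 4 / \<epsilon>) / (K - 1)
        + 320 * L / K / (K - 1) + 128 * L / K\<^sup>2)"
proof -
  have AB: "0 \<le> A" "0 \<le> B" using A[of undefined] B[of undefined] by linarith+
  have cont_\<phi>: "continuous_on UNIV \<phi>" and cont_\<psi>: "continuous_on UNIV \<psi>"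
    using \<phi> \<psi> by (simp_all add: doubly_periodic_def)
  obtain \<Phi> \<Phi>\<^sub>1 \<Phi>\<^sub>2 where \<Phi>: "\<And>u. (\<Phi> has_derivative (\<lambda>v. \<Phi>\<^sub>1 u * fst v + \<Phi>\<^sub>2 u * snd v)) (at u)"
    "continuous_on UNIV \<Phi>\<^sub>1"
    "\<And>u. \<bar>\<Phi> u\<bar> \<le> A" "\<And>u. \<bar>\<Phi>\<^sub>2 u\<bar> \<le> 2 * A / \<epsilon>" "\<And>u. \<bar>\<phi> u - \<Phi>\<^sub>1 u\<bar> \<le> A * \<epsilon> powr \<alpha>"
    using \<phi> by (rule_tac mollified_primitive[OF cont_\<phi> assms(3,4) _ mean A A_hol])
      (auto simp: doubly_periodic_def)
  define Osc where "Osc = (2 + 4 / \<epsilon>) / (K - 1) + (320 * L / K / (K - 1) + 128 * L / K\<^sup>2)"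
  define H where "H u = \<phi> ((lifted_map L ^^ n) u) * \<psi> u" for u
  define cut where "cut u = orbit_cutoff (snd u) n (fst u)" for u
  have H: "continuous_on UNIV H"
    unfolding H_def
    by (intro continuous_on_mult cont_\<psi> continuous_on_compose2[OF cont_\<phi> continuous_on_lifted_map_funpow]) auto
  have cut: "continuous_on UNIV cut" unfolding cut_def by (rule continuous_on_orbit_cutoff)
  have slice: "continuous_on S (\<lambda>x. h (x, y))" if "continuous_on UNIV h" for h :: "real \<times> real \<Rightarrow> real" and y S
    by (rule continuous_on_compose2[OF that]) (auto intro!: continuous_intros)
  have average: "continuous_on S (\<lambda>y. integral {0..1} (\<lambda>x. h (x, y)))"
    if "continuous_on UNIV h" for h :: "real \<times> real \<Rightarrow> real" and S
  proof -
    have "continuous_on (S \<times> cbox 0 1) (\<lambda>(y, x). h (x, y))"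
      unfolding case_prod_unfold
      by (intro continuous_on_compose2[OF that] continuous_intros) auto
    from integral_continuous_on_param[OF this] show ?thesis by simp
  qed
  have fibre: "\<bar>integral {0..1} (\<lambda>x. H (x, y))\<bar>
      \<le> A * B * integral {0..1} (\<lambda>x. 1 - cut (x, y)) + A * B * (2 * \<epsilon> powr \<alpha> + Osc)" for y
  proof -
    obtain g g' where g: "\<And>x. (g has_real_derivative g' x) (at x)" "\<And>x. \<bar>g x\<bar> \<le> B"
      "\<And>x. \<bar>g' x\<bar> \<le> 2 * B / \<epsilon>" "\<And>x. \<bar>\<psi> (x, y) - g x\<bar> \<le> B * \<epsilon> powr \<alpha>"
      using mollification_1d[OF slice[OF cont_\<psi>] assms(3,4) B B_hol] by metis
    define J where "J x = orbit_cutoff y n x * g x * \<Phi>\<^sub>1 (orbit L y (Suc n) x, orbit L y n x)" for x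
    have "\<bar>integral {0..1} J\<bar> \<le> (2 * A * B + A * (2 * B / \<epsilon>) + 2 * A / \<epsilon> * B) / (K - 1)
        + A * B * (320 * L / K / (K - 1) + 128 * L / K\<^sup>2)"
      unfolding J_def by (rule oscillatory_integral_bound[OF assms(1) \<Phi>(1-4) g(1-3)])
    also have "\<dots> = A * B * Osc" by (simp add: Osc_def algebra_simps add_divide_distrib)
    finally have J: "\<bar>integral {0..1} J\<bar> \<le> A * B * Osc" .
    have cont_g: "continuous_on UNIV g"
      using g(1) by (meson DERIV_isCont continuous_at_imp_continuous_on)
    have J_eq: "J x = cut (x, y) * g x * \<Phi>\<^sub>1 ((lifted_map L ^^ n) (x, y))" for x
      by (simp add: J_def cut_def lifted_map_funpow)
    have "continuous_on UNIV (\<lambda>x. \<Phi>\<^sub>1 ((lifted_map L ^^ n) (x, y)))"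
      by (rule slice[of "\<lambda>u. \<Phi>\<^sub>1 ((lifted_map L ^^ n) u)"])
        (auto intro!: continuous_on_compose2[OF \<Phi>(2) continuous_on_lifted_map_funpow])
    then have cont_J: "continuous_on UNIV J"
      unfolding J_eq using cont_g slice[OF cut] by (intro continuous_intros)
    have int: "h integrable_on {0..1}" if "continuous_on UNIV h" for h :: "real \<Rightarrow> real"
      by (rule integrable_continuous_real) (use that continuous_on_subset in blast)
    have "norm (integral {0..1} (\<lambda>x. H (x, y) - J x))
        \<le> integral {0..1} (\<lambda>x. A * B * (1 - cut (x, y)) + A * B * (2 * \<epsilon> powr \<alpha>))"
    proof (rule integral_norm_bound_integral)
      fix x
      define a where "a = \<phi> ((lifted_map L ^^ n) (x, y))"
      define b where "b = \<psi> (x, y)"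
      define c where "c = cut (x, y)"
      define p where "p = \<Phi>\<^sub>1 ((lifted_map L ^^ n) (x, y))"
      have c: "0 \<le> c" "c \<le> 1" using orbit_cutoff_range by (auto simp: c_def cut_def)
      have "H (x, y) - J x = a * b * (1 - c) + c * (a * (b - g x) + g x * (a - p))"
        by (simp add: H_def J_eq a_def b_def c_def p_def algebra_simps)
      also have "\<bar>\<dots>\<bar> \<le> \<bar>a\<bar> * \<bar>b\<bar> * (1 - c) + c * (\<bar>a\<bar> * \<bar>b - g x\<bar> + \<bar>g x\<bar> * \<bar>a - p\<bar>)"
      proof (rule order_trans[OF abs_triangle_ineq], rule add_mono)
        show "\<bar>a * b * (1 - c)\<bar> \<le> \<bar>a\<bar> * \<bar>b\<bar> * (1 - c)" using c by (simp add: abs_mult)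
        have "\<bar>a * (b - g x) + g x * (a - p)\<bar> \<le> \<bar>a\<bar> * \<bar>b - g x\<bar> + \<bar>g x\<bar> * \<bar>a - p\<bar>"
          by (rule order_trans[OF abs_triangle_ineq]) (simp add: abs_mult)
        then show "\<bar>c * (a * (b - g x) + g x * (a - p))\<bar>
            \<le> c * (\<bar>a\<bar> * \<bar>b - g x\<bar> + \<bar>g x\<bar> * \<bar>a - p\<bar>)"
          using c by (simp add: abs_mult mult_left_mono)
      qed
      also have "\<dots> \<le> A * B * (1 - c) + 1 * (A * (B * \<epsilon> powr \<alpha>) + B * (A * \<epsilon> powr \<alpha>))"
        using c A B g(2,4) \<Phi>(5) AB unfolding a_def b_def p_def
        by (intro add_mono mult_mono add_nonneg_nonneg mult_nonneg_nonneg) auto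
      finally show "norm (H (x, y) - J x) \<le> A * B * (1 - cut (x, y)) + A * B * (2 * \<epsilon> powr \<alpha>)"
        by (simp add: c_def algebra_simps)
    qed (intro int continuous_intros cont_J slice[OF H] slice[OF cut])+
    also have "\<dots> = A * B * integral {0..1} (\<lambda>x. 1 - cut (x, y)) + A * B * (2 * \<epsilon> powr \<alpha>)"
      by (subst Henstock_Kurzweil_Integration.integral_add)
        (auto intro!: int continuous_intros slice[OF cut])
    also have "integral {0..1} (\<lambda>x. H (x, y) - J x) = integral {0..1} (\<lambda>x. H (x, y)) - integral {0..1} J"
      by (intro Henstock_Kurzweil_Integration.integral_diff int cont_J slice[OF H])
    finally have "\<bar>integral {0..1} (\<lambda>x. H (x, y)) - integral {0..1} J\<bar>
        \<le> A * B * integral {0..1} (\<lambda>x. 1 - cut (x, y)) + A * B * (2 * \<epsilon> powr \<alpha>)" by simp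
    then show ?thesis using J unfolding distrib_left by linarith
  qed
  have cont_loss: "continuous_on UNIV (\<lambda>u. 1 - cut u)" by (intro continuous_intros cut)
  have "\<bar>unit_square_integral H\<bar> = norm (integral {0..1} (\<lambda>y. integral {0..1} (\<lambda>x. H (x, y))))"
    by (simp add: unit_square_integral_iterated(2)[OF H])
  also have "\<dots> \<le> integral {0..1} (\<lambda>y. A * B * integral {0..1} (\<lambda>x. 1 - cut (x, y)) + A * B * (2 * \<epsilon> powr \<alpha> + Osc))"
    using fibre
    by (intro integral_norm_bound_integral integrable_continuous_real continuous_intros
        average[OF H] average[OF cont_loss]) auto
  also have "\<dots> = A * B * unit_square_integral (\<lambda>u. 1 - cut u) + A * B * (2 * \<epsilon> powr \<alpha> + Osc)"
    unfolding unit_square_integral_iterated(2)[OF cont_loss]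
    by (subst Henstock_Kurzweil_Integration.integral_add)
      (auto intro!: integrable_continuous_real continuous_intros average[OF cont_loss])
  also have "\<dots> \<le> A * B * (real n * (6 * K / L)) + A * B * (2 * \<epsilon> powr \<alpha> + Osc)"
  proof (intro add_right_mono mult_left_mono)
    have "unit_square_integral (\<lambda>u. 1 - cut u) \<le> real n * integral {0..1} (\<lambda>x. 1 - cutoff x)"
      unfolding cut_def by (rule orbit_cutoff_mass)
    also have "\<dots> \<le> real n * (6 * K / L)"
      by (intro mult_left_mono integral_cutoff_complement assms) auto
    finally show "unit_square_integral (\<lambda>u. 1 - cut u) \<le> real n * (6 * K / L)" .
  qed (use AB in auto)
  finally show ?thesis by (simp add: H_def[abs_def] Osc_def distrib_left add.assoc)
qed

end

text \<open>
  The choice of scales: with \<open>L = r\<^sup>4\<close> take \<open>K = r\<^sup>3\<close> and \<open>\<epsilon> = 1 / r\<close>. Then the excluded mass per step is of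
  order \<open>K / L = 1 / r\<close>, while \<open>1 / (\<epsilon> K)\<close> and \<open>L / K\<^sup>2\<close> are both \<open>1 / r\<^sup>2\<close>, so everything is dominated by
  \<open>n\<close> times the mollification error \<open>r powr - \<alpha>\<close>.
\<close>

lemma zero_mean_correlation_decay:
  fixes \<phi> \<psi> :: "real \<times> real \<Rightarrow> real"
  assumes "1 \<le> n" "10 \<le> r" "0 < \<alpha>" "\<alpha> \<le> 1"
    and \<phi>: "doubly_periodic \<phi>" and \<psi>: "doubly_periodic \<psi>"
    and mean: "\<And>y. integral {0..1} (\<lambda>s. \<phi> (s, y)) = 0"
    and A: "\<And>u. \<bar>\<phi> u\<bar> \<le> A"
    and A_hol: "\<And>s y y'. \<bar>\<phi> (s, y) - \<phi> (s, y')\<bar> \<le> A * \<bar>y - y'\<bar> powr \<alpha>"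
    and B: "\<And>u. \<bar>\<psi> u\<bar> \<le> B"
    and B_hol: "\<And>x x' y. \<bar>\<psi> (x, y) - \<psi> (x', y)\<bar> \<le> B * \<bar>x - x'\<bar> powr \<alpha>"
  shows "\<bar>unit_square_integral (\<lambda>u. \<phi> ((lifted_map (r ^ 4) ^^ n) u) * \<psi> u)\<bar>
    \<le> 800 * A * B * (real n * r powr (- \<alpha>))"
proof -
  define \<delta> where "\<delta> = r powr (- \<alpha>)"
  have r: "0 < r" "1 \<le> r" using assms(2) by auto
  have r3: "1000 \<le> r ^ 3" using power_mono[of 10 r 3] assms(2) by simp
  interpret strong_kick "r ^ 4" "r ^ 3"
    by unfold_locales (use r3 r in auto)
  have AB: "0 \<le> A" "0 \<le> B" using A[of undefined] B[of undefined] by linarith+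
  have inv: "1 / r \<le> \<delta>"
    using powr_mono[of "-1" "-\<alpha>" r] assms(4) r by (simp add: \<delta>_def powr_minus_divide)
  have inv2: "1 / r\<^sup>2 \<le> 1 / r"
    using r by (intro divide_left_mono) (auto simp: power2_eq_square)
  have "0 \<le> \<delta>" by (simp add: \<delta>_def)
  then have n\<delta>: "\<delta> \<le> real n * \<delta>" using assms(1) mult_right_mono[of 1 "real n" \<delta>] by simp
  have K: "r ^ 3 / 2 \<le> r ^ 3 - 1" "0 < r ^ 3 - 1" using r3 by auto
  have "\<bar>unit_square_integral (\<lambda>u. \<phi> ((lifted_map (r ^ 4) ^^ n) u) * \<psi> u)\<bar>
    \<le> A * B * (real n * (6 * r ^ 3 / r ^ 4) + 2 * (1 / r) powr \<alpha> + (2 + 4 / (1 / r)) / (r ^ 3 - 1)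
        + 320 * r ^ 4 / r ^ 3 / (r ^ 3 - 1) + 128 * r ^ 4 / (r ^ 3)\<^sup>2)"
    using r by (intro zero_mean_correlation_bound assms) (auto simp: power_increasing)
  also have "\<dots> \<le> A * B * (800 * (real n * \<delta>))"
  proof (rule mult_left_mono)
    have "real n * (6 * r ^ 3 / r ^ 4) = 6 * (real n * (1 / r))"
      using r by (simp add: power_def eval_nat_numeral)
    also have "\<dots> \<le> 6 * (real n * \<delta>)" using inv by (intro mult_left_mono) auto
    finally have 1: "real n * (6 * r ^ 3 / r ^ 4) \<le> 6 * (real n * \<delta>)" .
    have 2: "(1 / r) powr \<alpha> = \<delta>" using r by (simp add: \<delta>_def powr_divide powr_minus_divide)
    have "(2 + 4 / (1 / r)) / (r ^ 3 - 1) \<le> (6 * r) / (r ^ 3 / 2)"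
      using K r by (intro frac_le) auto
    also have "\<dots> = 12 * (1 / r\<^sup>2)" using r by (simp add: power2_eq_square power3_eq_cube)
    finally have 3: "(2 + 4 / (1 / r)) / (r ^ 3 - 1) \<le> 12 * (1 / r\<^sup>2)" .
    have "320 * r ^ 4 / r ^ 3 / (r ^ 3 - 1) \<le> (320 * r) / (r ^ 3 / 2)"
      using K r by (intro frac_le) (auto simp: power_def eval_nat_numeral)
    also have "\<dots> = 640 * (1 / r\<^sup>2)" using r by (simp add: power2_eq_square power3_eq_cube)
    finally have 4: "320 * r ^ 4 / r ^ 3 / (r ^ 3 - 1) \<le> 640 * (1 / r\<^sup>2)" .
    have 5: "128 * r ^ 4 / (r ^ 3)\<^sup>2 = 128 * (1 / r\<^sup>2)"
      using r by (simp add: power_def eval_nat_numeral)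
    show "real n * (6 * r ^ 3 / r ^ 4) + 2 * (1 / r) powr \<alpha> + (2 + 4 / (1 / r)) / (r ^ 3 - 1)
        + 320 * r ^ 4 / r ^ 3 / (r ^ 3 - 1) + 128 * r ^ 4 / (r ^ 3)\<^sup>2 \<le> 800 * (real n * \<delta>)"
    proof -
      have q: "1 / r\<^sup>2 \<le> real n * \<delta>" using inv inv2 n\<delta> by linarith
      have "real n * (6 * r ^ 3 / r ^ 4) + 2 * (1 / r) powr \<alpha> + (2 + 4 / (1 / r)) / (r ^ 3 - 1)
          + 320 * r ^ 4 / r ^ 3 / (r ^ 3 - 1) + 128 * r ^ 4 / (r ^ 3)\<^sup>2
        \<le> 6 * (real n * \<delta>) + 2 * (real n * \<delta>) + 12 * (real n * \<delta>) + 640 * (real n * \<delta>)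
          + 128 * (real n * \<delta>)"
        unfolding 2 5
        by (intro add_mono 1 order_trans[OF 3] order_trans[OF 4] mult_left_mono n\<delta> q) auto
      also have "\<dots> = 788 * (real n * \<delta>)" by simp
      also have "\<dots> \<le> 800 * (real n * \<delta>)" using \<open>0 \<le> \<delta>\<close> by simp
      finally show ?thesis .
    qed
  qed (use AB in auto)
  finally show ?thesis by (simp add: \<delta>_def mult_ac)
qed

text \<open>
  An arbitrary observable is its deviation from the horizontal mean plus that mean. The deviation
  has zero mean on horizontal lines. The mean depends only on the second coordinate, which after
  \<open>n\<close> steps is the first coordinate after \<open>n - 1\<close> steps; read at that time it is, up to
  a constant, again an observable of zero horizontal mean. Hence the condition \<open>2 \<le> n\<close>: the second
  part needs a kick of its own.
\<close>

lemma correlation_decay: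
  fixes \<phi> \<psi> :: "real \<times> real \<Rightarrow> real"
  assumes "2 \<le> n" "10 \<le> r" "0 < \<alpha>" "\<alpha> \<le> 1"
    and \<phi>: "doubly_periodic \<phi>" and \<psi>: "doubly_periodic \<psi>"
    and A: "\<And>u. \<bar>\<phi> u\<bar> \<le> A" and A_hol: "\<And>u v. \<bar>\<phi> u - \<phi> v\<bar> \<le> A * dist u v powr \<alpha>"
    and B: "\<And>u. \<bar>\<psi> u\<bar> \<le> B" and B_hol: "\<And>u v. \<bar>\<psi> u - \<psi> v\<bar> \<le> B * dist u v powr \<alpha>"
  shows "\<bar>unit_square_integral (\<lambda>u. \<phi> ((lifted_map (r ^ 4) ^^ n) u) * \<psi> u)
      - unit_square_integral \<phi> * unit_square_integral \<psi>\<bar>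
    \<le> 3200 * A * B * (real n * r powr (- \<alpha>))"
proof -
  define F where "F = lifted_map (r ^ 4)"
  define \<delta> where "\<delta> = r powr (- \<alpha>)"
  define avg where "avg y = integral {0..1} (\<lambda>s. \<phi> (s, y))" for y
  define m where "m = unit_square_integral \<phi>"
  define \<phi>1 where "\<phi>1 u = \<phi> u - avg (snd u)" for u
  define \<phi>2 where "\<phi>2 u = avg (fst u) - m" for u :: "real \<times> real"
  have "0 \<le> A" "0 \<le> B" using A[of undefined] B[of undefined] by linarith+
  have cont_\<phi>: "continuous_on UNIV \<phi>" and cont_\<psi>: "continuous_on UNIV \<psi>"
    and per: "\<And>x y. \<phi> (x + 1, y) = \<phi> (x, y)" "\<And>x y. \<phi> (x, y + 1) = \<phi> (x, y)"
    using \<phi> \<psi> by (simp_all add: doubly_periodic_def)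
  have slice: "continuous_on S (\<lambda>x. \<phi> (x, y))" for y S
    by (rule continuous_on_compose2[OF cont_\<phi>]) (auto intro!: continuous_intros)
  have "continuous_on (UNIV \<times> cbox 0 1) (\<lambda>(y, x). \<phi> (x, y))"
    unfolding case_prod_unfold
    by (intro continuous_on_compose2[OF cont_\<phi>] continuous_intros) auto
  from integral_continuous_on_param[OF this]
  have cont_avg: "continuous_on UNIV avg" by (simp add: avg_def[abs_def])
  have avg_bound: "\<bar>avg y\<bar> \<le> A" for y
    using integral_bound[of 0 1 "\<lambda>s. \<phi> (s, y)" A] slice A by (simp add: avg_def)
  have avg_hol: "\<bar>avg y - avg y'\<bar> \<le> A * \<bar>y - y'\<bar> powr \<alpha>" for y y'
  proof -
    have "avg y - avg y' = integral {0..1} (\<lambda>s. \<phi> (s, y) - \<phi> (s, y'))"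
      unfolding avg_def
      by (intro Henstock_Kurzweil_Integration.integral_diff[symmetric] integrable_continuous_real slice)
    moreover have "norm (integral {0..1} (\<lambda>s. \<phi> (s, y) - \<phi> (s, y'))) \<le> A * \<bar>y - y'\<bar> powr \<alpha> * (1 - 0)"
    proof (rule integral_bound)
      show "norm (\<phi> (s, y) - \<phi> (s, y')) \<le> A * \<bar>y - y'\<bar> powr \<alpha>" for s
        using A_hol[of "(s, y)" "(s, y')"] by (simp add: dist_Pair_Pair dist_real_def)
    qed (auto intro!: continuous_intros slice)
    ultimately show ?thesis by simp
  qed
  have avg_int: "integral {0..1} avg = m"
    using unit_square_integral_iterated(2)[OF cont_\<phi>] by (simp add: m_def avg_def[abs_def])
  have m_bound: "\<bar>m\<bar> \<le> A"
    using integral_bound[of 0 1 avg A] avg_bound continuous_on_subset[OF cont_avg] avg_int by simp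
  have avg_per: "avg (y + 1) = avg y" for y by (simp add: avg_def per)
  have c1: "continuous_on UNIV (\<lambda>u :: real \<times> real. avg (fst u))"
    "continuous_on UNIV (\<lambda>u :: real \<times> real. avg (snd u))"
    by (intro continuous_on_compose2[OF cont_avg] continuous_intros; simp)+
  have dp1: "doubly_periodic \<phi>1"
    unfolding doubly_periodic_def \<phi>1_def using cont_\<phi> c1 per avg_per
    by (auto intro!: continuous_intros)
  have dp2: "doubly_periodic \<phi>2"
    unfolding doubly_periodic_def \<phi>2_def using c1 avg_per by (auto intro!: continuous_intros)
  have \<psi>_hol: "\<bar>\<psi> (x, y) - \<psi> (x', y)\<bar> \<le> B * \<bar>x - x'\<bar> powr \<alpha>" for x x' y
    using B_hol[of "(x, y)" "(x', y)"] by (simp add: dist_Pair_Pair dist_real_def)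
  have 1: "\<bar>unit_square_integral (\<lambda>u. \<phi>1 ((F ^^ n) u) * \<psi> u)\<bar> \<le> 800 * (2 * A) * B * (real n * \<delta>)"
    unfolding F_def \<delta>_def
  proof (rule zero_mean_correlation_decay[OF _ assms(2-4) dp1 \<psi> _ _ _ B \<psi>_hol])
    show "integral {0..1} (\<lambda>s. \<phi>1 (s, y)) = 0" for y
    proof -
      have "integral {0..1} (\<lambda>s. \<phi> (s, y) - c) = avg y - c" for c
        by (subst Henstock_Kurzweil_Integration.integral_diff)
          (auto intro!: integrable_continuous_real slice simp: avg_def)
      then show ?thesis by (simp add: \<phi>1_def)
    qed
    show "\<bar>\<phi>1 u\<bar> \<le> 2 * A" for u
      using A[of u] avg_bound[of "snd u"] unfolding \<phi>1_def by linarith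
    show "\<bar>\<phi>1 (s, y) - \<phi>1 (s, y')\<bar> \<le> 2 * A * \<bar>y - y'\<bar> powr \<alpha>" for s y y'
    proof -
      have "\<bar>\<phi> (s, y) - \<phi> (s, y')\<bar> \<le> A * \<bar>y - y'\<bar> powr \<alpha>"
        using A_hol[of "(s, y)" "(s, y')"] by (simp add: dist_Pair_Pair dist_real_def)
      with avg_hol[of y y'] show ?thesis unfolding \<phi>1_def by simp
    qed
  qed (use assms(1) in auto)
  have 2: "\<bar>unit_square_integral (\<lambda>u. \<phi>2 ((F ^^ (n - 1)) u) * \<psi> u)\<bar>
      \<le> 800 * (2 * A) * B * (real (n - 1) * \<delta>)"
    unfolding F_def \<delta>_def
  proof (rule zero_mean_correlation_decay[OF _ assms(2-4) dp2 \<psi> _ _ _ B \<psi>_hol])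
    show "integral {0..1} (\<lambda>s. \<phi>2 (s, y)) = 0" for y
    proof -
      have "integral {0..1} (\<lambda>s. avg s - m) = integral {0..1} avg - m"
        by (subst Henstock_Kurzweil_Integration.integral_diff)
          (auto intro!: integrable_continuous_real continuous_on_subset[OF cont_avg])
      then show ?thesis by (simp add: \<phi>2_def avg_int)
    qed
    show "\<bar>\<phi>2 u\<bar> \<le> 2 * A" for u
      using m_bound avg_bound[of "fst u"] unfolding \<phi>2_def by linarith
    show "\<bar>\<phi>2 (s, y) - \<phi>2 (s, y')\<bar> \<le> 2 * A * \<bar>y - y'\<bar> powr \<alpha>" for s y y'
      using \<open>0 \<le> A\<close> by (simp add: \<phi>2_def)
  qed (use assms(1) in auto)
  have split: "\<phi> ((F ^^ n) u) = \<phi>1 ((F ^^ n) u) + \<phi>2 ((F ^^ (n - 1)) u) + m" for u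
  proof -
    obtain k where "n = Suc k" using assms(1) by (cases n) auto
    then have "snd ((F ^^ n) u) = fst ((F ^^ (n - 1)) u)" by (simp add: F_def lifted_map_def)
    then show ?thesis by (simp add: \<phi>1_def \<phi>2_def)
  qed
  have comp: "continuous_on UNIV (\<lambda>u. h ((F ^^ k) u))" if "continuous_on UNIV h"
    for h :: "real \<times> real \<Rightarrow> real" and k
    unfolding F_def by (rule continuous_on_compose2[OF that continuous_on_lifted_map_funpow]) auto
  have c: "continuous_on UNIV \<phi>1" "continuous_on UNIV \<phi>2"
    using dp1 dp2 by (simp_all add: doubly_periodic_def)
  have int: "(\<lambda>u. \<phi>1 ((F ^^ n) u) * \<psi> u) integrable_on cbox (0, 0) (1, 1)"
    "(\<lambda>u. \<phi>2 ((F ^^ (n - 1)) u) * \<psi> u) integrable_on cbox (0, 0) (1, 1)"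
    "(\<lambda>u. m * \<psi> u) integrable_on cbox (0, 0) (1, 1)"
    by (rule unit_square_integrable, rule continuous_on_mult, simp_all add: comp c cont_\<psi>)+
  have "unit_square_integral (\<lambda>u. \<phi> ((F ^^ n) u) * \<psi> u) =
      unit_square_integral (\<lambda>u. (\<phi>1 ((F ^^ n) u) * \<psi> u + \<phi>2 ((F ^^ (n - 1)) u) * \<psi> u) + m * \<psi> u)"
    by (simp add: split distrib_right)
  also have "\<dots> = unit_square_integral (\<lambda>u. \<phi>1 ((F ^^ n) u) * \<psi> u)
      + unit_square_integral (\<lambda>u. \<phi>2 ((F ^^ (n - 1)) u) * \<psi> u) + m * unit_square_integral \<psi>"
    unfolding unit_square_integral_def
    using Henstock_Kurzweil_Integration.integral_add[OF integrable_add[OF int(1,2)] int(3)]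
      Henstock_Kurzweil_Integration.integral_add[OF int(1,2)] by simp
  finally have "\<bar>unit_square_integral (\<lambda>u. \<phi> ((F ^^ n) u) * \<psi> u) - m * unit_square_integral \<psi>\<bar>
      \<le> 800 * (2 * A) * B * (real n * \<delta>) + 800 * (2 * A) * B * (real (n - 1) * \<delta>)"
    using 1 2 by linarith
  also have "\<dots> \<le> 800 * (2 * A) * B * (real n * \<delta>) + 800 * (2 * A) * B * (real n * \<delta>)"
    using \<open>0 \<le> A\<close> \<open>0 \<le> B\<close> by (intro add_left_mono mult_left_mono mult_right_mono) (auto simp: \<delta>_def)
  finally show ?thesis by (simp add: F_def \<delta>_def m_def)
qed

lemma holder_continuous_lift:
  assumes "0 < \<alpha>" "holder_continuous \<alpha> \<phi>"
  shows "doubly_periodic (\<lambda>u. \<phi> (torus_proj u))"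
    "\<bar>\<phi> (torus_proj u)\<bar> \<le> holder_norm \<alpha> \<phi>"
    "\<bar>\<phi> (torus_proj u) - \<phi> (torus_proj v)\<bar> \<le> holder_norm \<alpha> \<phi> * dist u v powr \<alpha>"
proof -
  define H where "H = holder_seminorm \<alpha> \<phi>"
  have quotient: "\<bar>\<phi> p - \<phi> q\<bar> / dist p q powr \<alpha> \<le> H" if "p \<noteq> q" for p q
    unfolding H_def holder_seminorm_def
    using assms(2) that by (intro cSup_upper) (auto simp: holder_continuous_def holder_quotients_def)
  have "torus_proj (0, 0) \<noteq> torus_proj (1 / 2, 0)"
  proof -
    have "(- 1 / 2 :: real) \<notin> \<int>" by (auto elim!: Ints_cases simp: field_simps)
    then show ?thesis by (simp add: torus_proj_eq_iff lattice_rel_def)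
  qed
  from quotient[OF this] have "0 \<le> H"
    by (rule order_trans[rotated]) simp
  have hol: "\<bar>\<phi> (torus_proj u) - \<phi> (torus_proj v)\<bar> \<le> H * dist u v powr \<alpha>" for u v :: "real \<times> real"
  proof (cases "torus_proj u = torus_proj v")
    case True
    then show ?thesis using \<open>0 \<le> H\<close> by simp
  next
    case False
    then have "\<bar>\<phi> (torus_proj u) - \<phi> (torus_proj v)\<bar> \<le> H * dist (torus_proj u) (torus_proj v) powr \<alpha>"
      using quotient[OF False] by (simp add: divide_le_eq)
    also have "\<dots> \<le> H * dist u v powr \<alpha>"
      using \<open>0 \<le> H\<close> \<open>0 < \<alpha>\<close> by (intro mult_left_mono powr_mono2 dist_torus2_le) auto
    finally show ?thesis .
  qed
  have cont: "continuous_on UNIV (\<lambda>u. \<phi> (torus_proj u))"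
    unfolding continuous_on_def
  proof
    fix u :: "real \<times> real"
    have "((\<lambda>v. H * dist v u powr \<alpha>) \<longlongrightarrow> H * dist u u powr \<alpha>) (at u)"
      using \<open>0 < \<alpha>\<close> by (intro tendsto_intros tendsto_powr') auto
    then have null: "((\<lambda>v. H * dist v u powr \<alpha>) \<longlongrightarrow> 0) (at u)" by simp
    have "((\<lambda>v. \<phi> (torus_proj v) - \<phi> (torus_proj u)) \<longlongrightarrow> 0) (at u)"
      by (rule Lim_null_comparison[OF _ null], rule always_eventually) (simp add: hol)
    then show "((\<lambda>v. \<phi> (torus_proj v)) \<longlongrightarrow> \<phi> (torus_proj u)) (at u within UNIV)"
      by (simp add: LIM_zero_iff)
  qed
  then show "doubly_periodic (\<lambda>u. \<phi> (torus_proj u))"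
    by (simp add: doubly_periodic_def torus_proj_shift)
  have sup: "\<bar>\<phi> p\<bar> \<le> sup_norm \<phi>" for p
    unfolding sup_norm_def
  proof (rule cSUP_upper)
    have "compact ((\<lambda>u. \<phi> (torus_proj u)) ` cbox (0, 0) (1, 1))"
      by (rule compact_continuous_image[OF continuous_on_subset[OF cont]]) auto
    then have "bounded ((\<lambda>u. \<phi> (torus_proj u)) ` cbox (0, 0) (1, 1))" by (rule compact_imp_bounded)
    then obtain M where M: "\<And>u. u \<in> cbox (0, 0) (1, 1) \<Longrightarrow> \<bar>\<phi> (torus_proj u)\<bar> \<le> M"
      unfolding bounded_iff by auto
    have "\<bar>\<phi> p\<bar> \<le> M" for p
    proof -
      obtain x y where xy: "torus_rep p = (x, y)" by fastforce
      have "lattice_rel (x, y) (frac x, frac y)" by (simp add: lattice_rel_def frac_def)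
      then have "torus_proj (frac x, frac y) = p" using xy by (metis torus_proj_eq_iff torus_proj_rep)
      moreover have "(frac x, frac y) \<in> cbox (0, 0) (1, 1)"
        by (simp add: cbox_Pair_eq frac_ge_0 frac_lt_1 less_imp_le)
      ultimately show ?thesis using M by metis
    qed
    then show "bdd_above (range (\<lambda>p. \<bar>\<phi> p\<bar>))" by (intro bdd_aboveI) auto
  qed simp
  have "0 \<le> sup_norm \<phi>" using sup[of undefined] by linarith
  then show "\<bar>\<phi> (torus_proj u) - \<phi> (torus_proj v)\<bar> \<le> holder_norm \<alpha> \<phi> * dist u v powr \<alpha>"
    by (intro order_trans[OF hol] mult_right_mono) (auto simp: holder_norm_def H_def)
  show "\<bar>\<phi> (torus_proj u)\<bar> \<le> holder_norm \<alpha> \<phi>"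
    using sup[of "torus_proj u"] \<open>0 \<le> H\<close> by (simp add: holder_norm_def H_def)
qed

text \<open>
  With \<open>L = r\<^sup>4\<close> the decay rate obtained is \<open>L powr (- \<alpha> / 4)\<close>, and \<open>\<alpha> / (3 * \<alpha> + 4) \<le> \<alpha> / 4\<close>.
\<close>

theorem theorem4:
  fixes \<alpha> :: real
  assumes "0 < \<alpha>" and "\<alpha> \<le> 1"
  shows "\<exists>L\<^sub>0 > 0. \<exists>C > 0. \<forall>L \<ge> L\<^sub>0. \<forall>\<phi> \<psi> :: torus2 \<Rightarrow> real. \<forall>n \<ge> (2 :: nat).
    holder_continuous \<alpha> \<phi> \<longrightarrow> holder_continuous \<alpha> \<psi> \<longrightarrow>
    \<bar>(\<integral>p. \<phi> ((standard_map L ^^ n) p) * \<psi> p \<partial>torus_measure)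
      - (\<integral>p. \<phi> p \<partial>torus_measure) * (\<integral>p. \<psi> p \<partial>torus_measure)\<bar>
    \<le> C * holder_norm \<alpha> \<phi> * holder_norm \<alpha> \<psi> * (real n * L powr (- \<alpha> / (3 * \<alpha> + 4)))"
proof (rule exI[of _ 10000], intro conjI, simp, rule exI[of _ 3200], intro conjI allI impI)
  fix L :: real and \<phi> \<psi> :: "torus2 \<Rightarrow> real" and n :: nat
  assume L: "10000 \<le> L" and n: "2 \<le> n" and \<phi>: "holder_continuous \<alpha> \<phi>" and \<psi>: "holder_continuous \<alpha> \<psi>"
  define r where "r = L powr (1 / 4)"
  have r4: "r ^ 4 = L" using L by (simp add: r_def powr_power)
  have "10 \<le> r"
  proof (rule power_le_imp_le_base)
    show "10 ^ Suc 3 \<le> r ^ Suc 3" using L r4 by simp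
  qed (simp add: r_def)
  have rate: "r powr (- \<alpha>) \<le> L powr (- \<alpha> / (3 * \<alpha> + 4))"
  proof -
    have "r powr (- \<alpha>) = L powr (- (\<alpha> / 4))" by (simp add: r_def powr_powr)
    also have "\<dots> \<le> L powr (- \<alpha> / (3 * \<alpha> + 4))"
    proof (rule powr_mono)
      have "\<alpha> / (3 * \<alpha> + 4) \<le> \<alpha> / 4" using assms by (intro divide_left_mono) auto
      then show "- (\<alpha> / 4) \<le> - \<alpha> / (3 * \<alpha> + 4)" by simp
    qed (use L in simp)
    finally show ?thesis .
  qed
  note lift_\<phi> = holder_continuous_lift[OF assms(1) \<phi>] and lift_\<psi> = holder_continuous_lift[OF assms(1) \<psi>]
  have cont: "continuous_on UNIV (\<lambda>u. \<phi> (torus_proj u))" "continuous_on UNIV (\<lambda>u. \<psi> (torus_proj u))"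
    using lift_\<phi>(1) lift_\<psi>(1) by (simp_all add: doubly_periodic_def)
  have "continuous_on UNIV (\<lambda>u. \<phi> ((standard_map L ^^ n) (torus_proj u)) * \<psi> (torus_proj u))"
    unfolding standard_map_funpow_proj
    by (intro continuous_on_mult cont continuous_on_compose2[OF cont(1) continuous_on_lifted_map_funpow]) auto
  note int = integral_torus_measure[OF this, unfolded standard_map_funpow_proj]
    integral_torus_measure[OF cont(1)] integral_torus_measure[OF cont(2)]
  have "\<bar>(\<integral>p. \<phi> ((standard_map L ^^ n) p) * \<psi> p \<partial>torus_measure)
      - (\<integral>p. \<phi> p \<partial>torus_measure) * (\<integral>p. \<psi> p \<partial>torus_measure)\<bar>
    \<le> 3200 * holder_norm \<alpha> \<phi> * holder_norm \<alpha> \<psi> * (real n * r powr (- \<alpha>))"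
    unfolding int
    using correlation_decay[OF n \<open>10 \<le> r\<close> assms lift_\<phi>(1) lift_\<psi>(1) lift_\<phi>(2,3) lift_\<psi>(2,3)]
    unfolding r4 .
  also have "\<dots> \<le> 3200 * holder_norm \<alpha> \<phi> * holder_norm \<alpha> \<psi> * (real n * L powr (- \<alpha> / (3 * \<alpha> + 4)))"
    using rate lift_\<phi>(2)[of undefined] lift_\<psi>(2)[of undefined]
    by (intro mult_left_mono mult_nonneg_nonneg) auto
  finally show "\<bar>(\<integral>p. \<phi> ((standard_map L ^^ n) p) * \<psi> p \<partial>torus_measure)
      - (\<integral>p. \<phi> p \<partial>torus_measure) * (\<integral>p. \<psi> p \<partial>torus_measure)\<bar>
    \<le> 3200 * holder_norm \<alpha> \<phi> * holder_norm \<alpha> \<psi> * (real n * L powr (- \<alpha> / (3 * \<alpha> + 4)))" .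
qed auto

end
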